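(* Let $n\ge 3$. For $z,y\in\mathbb K=\mathbb C(\mathsf u,\mathsf v)$ let $\tau$ be the Markov trace with parameters $z,y$ on the Hecke algebra of type $\mathtt B$, $\mathrm H_n(\mathsf u,\mathsf v)$. Then $\tau$ passes to the quotient algebra $\mathrm{TL}_n^{\mathtt B}(\mathsf u,\mathsf v)$ if and only if the pair $(z,y)$ takes one of the following values: (i) $z=-\frac1{\mathsf u}$ and $y=-\frac1{\mathsf v}$; (ii) $z=-\frac1{\mathsf u}$ and $y=\mathsf v$; (iii) $z=-\frac{1}{\mathsf u(1+\mathsf u^2)}$ and $y=-\frac1{\mathsf v}$; (iv) $z=-\frac{1}{\mathsf u(1+\mathsf u^2)}$ and $y=\frac{-1+\mathsf v^2}{(1+\mathsf u^2)\mathsf v}$.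
   Context: $\mathsf u,\mathsf v$ are indeterminates and $\mathbb K=\mathbb C(\mathsf u,\mathsf v)$; algebras are associative unital $\mathbb K$-algebras. Hecke algebra of type $\mathtt B$: $\mathrm H_n(\mathsf u,\mathsf v)$ is generated by $b_1,g_1,\dots,g_{n-1}$ with relations $g_ig_j=g_jg_i$ for $|i-j|>1$; $g_ig_{i+1}g_i=g_{i+1}g_ig_{i+1}$; $b_1g_i=g_ib_1$ for $i>1$; $b_1g_1b_1g_1=g_1b_1g_1b_1$; $g_i^2=1+(\mathsf u-\mathsf u^{-1})g_i$; $b_1^2=1+(\mathsf v-\mathsf v^{-1})b_1$. It has dimension $2^nn!$, and $\mathrm H_n(\mathsf u,\mathsf v)\subset \mathrm H_{n+1}(\mathsf u,\mathsf v)$ naturally. Put $b_k:=g_{k-1}\cdots g_1b_1g_1^{-1}\cdots g_{k-1}^{-1}$ for $k\geq 2$. Markov trace (a known result): for any parameters $z,y$ there is a unique linear $\tau$ on $\bigcup_{n\ge1}\mathrm H_n(\mathsf u,\mathsf v)$ with $\tau(1)=1$; $\tau(ab)=\tau(ba)$; $\tau(ag_n)=z\,\tau(a)$ for $a\in\mathrm H_n(\mathsf u,\mathsf v)$; $\tau(ab_{n+1})=y\,\tau(a)$ for $a\in \mathrm H_n(\mathsf u,\mathsf v)$. Let $g_{1,2}=1+\mathsf u(g_1+g_2)+\mathsf u^2(g_1g_2+g_2g_1)+\mathsf u^3g_1g_2g_1$ and $g_{\mathtt B}=1+\mathsf u g_1+\mathsf v b_1+\mathsf u\mathsf v(g_1b_1+b_1g_1)+\mathsf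 u^2\mathsf v\,g_1b_1g_1+\mathsf v^2\mathsf u\,b_1g_1b_1+(\mathsf u\mathsf v)^2g_1b_1g_1b_1$. Let $J_B=\langle g_{\mathtt B},g_{1,2}\rangle$ be the two-sided ideal of $\mathrm H_n(\mathsf u,\mathsf v)$ generated by these elements. The Temperley-Lieb algebra of type $\mathtt B$ is $\mathrm{TL}_n^{\mathtt B}(\mathsf u,\mathsf v):=\mathrm H_n(\mathsf u,\mathsf v)/J_B$. The trace $\tau$ passes to the quotient if $\tau$ vanishes on $J_B$. *)

theory Defs
  imports
    "HOL-Library.Poly_Mapping"
    "HOL-Computational_Algebra.Polynomial"
    "HOL-Computational_Algebra.Fraction_Field"
    "HOL-Algebra.QuotRing"
begin

section \<open>The field of rational functions in two indeterminates\<close>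

text \<open>The fraction field of \<open>\<complex>[u][v]\<close>: the inner polynomial variable is \<open>u\<close>, the outer one \<open>v\<close>.\<close>

type_synonym ratfun = "complex poly poly fract"

definition ind_u :: ratfun where
  "ind_u = Fract [:[:0, 1:]:] 1"

definition ind_v :: ratfun where
  "ind_v = Fract [:0, 1:] 1"


section \<open>Free algebras\<close>

text \<open>Words with concatenation, written additively so that \<^typ>\<open>'a \<Rightarrow>\<^sub>0 'k\<close> carries the
  convolution product: finitely supported functions on words form the free algebra.\<close>

datatype 'a free_word = Word (letters: "'a list")

instantiation free_word :: (type) monoid_add
begin

definition zero_free_word :: "'a free_word" where
  "0 = Word []"

definition plus_free_word :: "'a free_word \<Rightarrow> 'a free_word \<Rightarrow> 'a free_word" where
  "w + w' = Word (letters w @ letters w')"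

instance
  by standard (simp_all add: zero_free_word_def plus_free_word_def)

end

definition free_gen :: "'a \<Rightarrow> ('a free_word \<Rightarrow>\<^sub>0 'k::comm_ring_1)" where
  "free_gen x = Poly_Mapping.single (Word [x]) 1"

definition scal :: "'k::comm_ring_1 \<Rightarrow> ('a free_word \<Rightarrow>\<^sub>0 'k)" where
  "scal c = Poly_Mapping.single 0 c"

definition free_algebra :: "'a set \<Rightarrow> ('a free_word \<Rightarrow>\<^sub>0 'k::comm_ring_1) ring" where
  "free_algebra X =
    \<lparr>carrier = {p. \<forall>w \<in> Poly_Mapping.keys p. set (letters w) \<subseteq> X},
     mult = (*), one = 1, zero = 0, add = (+)\<rparr>"

lemma free_algebra_simps:
  "mult (free_algebra X) = (*)" "one (free_algebra X) = 1"
  "zero (free_algebra X) = 0" "add (free_algebra X) = (+)"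
  by (simp_all add: free_algebra_def)

lemma free_algebra_closed:
  shows free_algebra_zero: "0 \<in> carrier (free_algebra X)"
    and free_algebra_one: "1 \<in> carrier (free_algebra X)"
    and free_algebra_add: "\<And>p q. p \<in> carrier (free_algebra X) \<Longrightarrow> q \<in> carrier (free_algebra X)
      \<Longrightarrow> p + q \<in> carrier (free_algebra X)"
    and free_algebra_uminus: "\<And>p. p \<in> carrier (free_algebra X) \<Longrightarrow> - p \<in> carrier (free_algebra X)"
    and free_algebra_mult: "\<And>p q. p \<in> carrier (free_algebra X) \<Longrightarrow> q \<in> carrier (free_algebra X)
      \<Longrightarrow> p * q \<in> carrier (free_algebra X)"
    and free_algebra_scal: "scal c \<in> carrier (free_algebra X)"
    and free_algebra_gen: "x \<in> X \<Longrightarrow> free_gen x \<in> carrier (free_algebra X)"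
proof -
  show "p + q \<in> carrier (free_algebra X)"
    if "p \<in> carrier (free_algebra X)" "q \<in> carrier (free_algebra X)" for p q
    using that Poly_Mapping.keys_add[of p q] by (auto simp: free_algebra_def)
  show "p * q \<in> carrier (free_algebra X)"
    if "p \<in> carrier (free_algebra X)" "q \<in> carrier (free_algebra X)" for p q
    using that Poly_Mapping.keys_mult[of p q]
    by (fastforce simp: free_algebra_def plus_free_word_def)
  show "1 \<in> carrier (free_algebra X)"
    by (auto simp: free_algebra_def zero_free_word_def simp flip: single_one split: if_splits)
qed (auto simp: free_algebra_def scal_def free_gen_def zero_free_word_def split: if_splits)

lemma free_algebra_minus:
  "p \<in> carrier (free_algebra X) \<Longrightarrow> q \<in> carrier (free_algebra X)
    \<Longrightarrow> p - q \<in> carrier (free_algebra X)"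
  using free_algebra_add[of p X "- q"] by (simp add: free_algebra_uminus)

lemma free_algebra_power: "p \<in> carrier (free_algebra X) \<Longrightarrow> p ^ k \<in> carrier (free_algebra X)"
  by (induction k) (auto intro: free_algebra_closed)

lemma ring_free_algebra: "ring (free_algebra X)"
proof (intro ringI abelian_groupI monoidI)
  fix p assume "p \<in> carrier (free_algebra X)"
  then show "\<exists>q \<in> carrier (free_algebra X). q \<oplus>\<^bsub>free_algebra X\<^esub> p = \<zero>\<^bsub>free_algebra X\<^esub>"
    by (intro bexI[of _ "- p"]) (auto simp: free_algebra_simps free_algebra_closed)
qed (auto simp: free_algebra_simps free_algebra_closed algebra_simps)


section \<open>The Hecke algebra of type B\<close>

datatype hgen = GenB | GenG nat

type_synonym free_elt = "hgen free_word \<Rightarrow>\<^sub>0 ratfun"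

abbreviation B1 :: free_elt where
  "B1 \<equiv> free_gen GenB"

abbreviation G :: "nat \<Rightarrow> free_elt" where
  "G i \<equiv> free_gen (GenG i)"

definition hecke_gens :: "nat \<Rightarrow> hgen set" where
  "hecke_gens n = insert GenB (GenG ` {1..<n})"

abbreviation hecke_free :: "nat \<Rightarrow> free_elt ring" where
  "hecke_free n \<equiv> free_algebra (hecke_gens n)"

text \<open>A relation \<open>l = r\<close> is encoded as the element \<open>l - r\<close>.\<close>

definition hecke_relations :: "nat \<Rightarrow> free_elt set" where
  "hecke_relations n =
     {G i * G j - G j * G i | i j. i \<in> {1..<n} \<and> j \<in> {1..<n} \<and> \<bar>int i - int j\<bar> > 1}
   \<union> {G i * G (i + 1) * G i - G (i + 1) * G i * G (i + 1) | i. i \<in> {1..<n} \<and> i + 1 \<in> {1..<n}}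
   \<union> {B1 * G i - G i * B1 | i. i \<in> {1..<n} \<and> i > 1}
   \<union> {B1 * G i * B1 * G i - G i * B1 * G i * B1 | i. i \<in> {1..<n} \<and> i = 1}
   \<union> {G i ^ 2 - (1 + scal (ind_u - inverse ind_u) * G i) | i. i \<in> {1..<n}}
   \<union> {B1 ^ 2 - (1 + scal (ind_v - inverse ind_v) * B1)}"

definition hecke_ideal :: "nat \<Rightarrow> free_elt set" where
  "hecke_ideal n = Idl\<^bsub>hecke_free n\<^esub> (hecke_relations n)"

definition hecke :: "nat \<Rightarrow> free_elt set ring" where
  "hecke n = hecke_free n Quot hecke_ideal n"

definition hecke_class :: "nat \<Rightarrow> free_elt \<Rightarrow> free_elt set" where
  "hecke_class n p = hecke_ideal n +>\<^bsub>hecke_free n\<^esub> p"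

definition hecke_scale :: "nat \<Rightarrow> ratfun \<Rightarrow> free_elt set \<Rightarrow> free_elt set" where
  "hecke_scale n c a = hecke_class n (scal c) \<otimes>\<^bsub>hecke n\<^esub> a"

text \<open>The natural map from \<open>H\<^sub>n\<close> to \<open>H\<^bsub>n+1\<^esub>\<close>: a coset of the smaller ideal is enlarged to the coset
  of the bigger one containing it; see \<open>hecke_incl_class\<close> below.\<close>

definition hecke_incl :: "nat \<Rightarrow> free_elt set \<Rightarrow> free_elt set" where
  "hecke_incl n a = hecke_ideal (n + 1) <+>\<^bsub>hecke_free (n + 1)\<^esub> a"

text \<open>\<open>hecke_b n k\<close> is \<open>b\<^sub>k\<close> as an element of \<open>H\<^sub>n\<close>, meant for \<open>1 \<le> k \<le> n\<close>.\<close>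

definition hecke_b :: "nat \<Rightarrow> nat \<Rightarrow> free_elt set" where
  "hecke_b n k =
    fold (\<lambda>i x. hecke_class n (G i) \<otimes>\<^bsub>hecke n\<^esub> x \<otimes>\<^bsub>hecke n\<^esub> inv\<^bsub>hecke n\<^esub> (hecke_class n (G i)))
      [1..<k] (hecke_class n B1)"

lemma hecke_relations_subset: "hecke_relations n \<subseteq> carrier (hecke_free n)"
proof -
  have "B1 \<in> carrier (hecke_free n)" "\<And>i. i \<in> {1..<n} \<Longrightarrow> G i \<in> carrier (hecke_free n)"
    by (auto intro!: free_algebra_gen simp: hecke_gens_def)
  then show ?thesis
    unfolding hecke_relations_def
    by (auto simp: free_algebra_closed free_algebra_minus free_algebra_power)
qed

lemma ideal_hecke_ideal: "ideal (hecke_ideal n) (hecke_free n)"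
  unfolding hecke_ideal_def
  by (intro ring.genideal_ideal ring_free_algebra hecke_relations_subset)

lemma ring_hecke: "ring (hecke n)"
  unfolding hecke_def by (rule ideal.quotient_is_ring[OF ideal_hecke_ideal])

lemma carrier_hecke: "carrier (hecke n) = hecke_class n ` carrier (hecke_free n)"
  by (auto simp: hecke_def FactRing_def A_RCOSETS_def' hecke_class_def)

lemma hecke_class_hom: "hecke_class n \<in> ring_hom (hecke_free n) (hecke n)"
  using ideal.rcos_ring_hom[OF ideal_hecke_ideal, of n]
  by (simp add: hecke_def hecke_class_def[abs_def])

lemma hecke_class_eq_iff:
  assumes "p \<in> carrier (hecke_free n)" "q \<in> carrier (hecke_free n)"
  shows "hecke_class n p = hecke_class n q \<longleftrightarrow> p - q \<in> hecke_ideal n"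
proof -
  interpret ideal "hecke_ideal n" "hecke_free n" by (rule ideal_hecke_ideal)
  have "\<ominus>\<^bsub>hecke_free n\<^esub> q = - q"
    using assms(2) by (intro minus_equality) (auto simp: free_algebra_simps free_algebra_closed)
  then have "p \<ominus>\<^bsub>hecke_free n\<^esub> q = p - q"
    by (simp add: a_minus_def free_algebra_simps)
  then show ?thesis
    using quotient_eq_iff_same_a_r_cos[OF ideal_hecke_ideal assms] by (simp add: hecke_class_def)
qed

lemma hecke_incl_class:
  assumes "p \<in> carrier (hecke_free n)"
  shows "hecke_incl n (hecke_class n p) = hecke_class (n + 1) p"
proof -
  let ?I = "hecke_ideal n" and ?J = "hecke_ideal (n + 1)"
  have gens: "hecke_gens n \<subseteq> hecke_gens (n + 1)"
    by (auto simp: hecke_gens_def)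
  then have car: "carrier (hecke_free n) \<subseteq> carrier (hecke_free (n + 1))"
    by (auto simp: free_algebra_def)
  interpret J: ideal ?J "hecke_free (n + 1)" by (rule ideal_hecke_ideal)
  have "hecke_relations n \<subseteq> hecke_relations (n + 1)"
    unfolding hecke_relations_def
    by (intro Un_mono Collect_mono subset_refl) (fastforce simp del: One_nat_def)+
  also have "\<dots> \<subseteq> ?J"
    unfolding hecke_ideal_def
    by (intro ring.genideal_self ring_free_algebra hecke_relations_subset)
  finally have rel: "hecke_relations n \<subseteq> ?J \<inter> carrier (hecke_free n)"
    using hecke_relations_subset by blast
  have "ideal (?J \<inter> carrier (hecke_free n)) (hecke_free n)"
  proof (rule idealI[OF ring_free_algebra])
    interpret F: ring "hecke_free n" by (rule ring_free_algebra)
    have neg: "\<ominus>\<^bsub>hecke_free m\<^esub> q = - q" if "q \<in> carrier (hecke_free m)" for m q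
      using that by (intro abelian_group.minus_equality ring.is_abelian_group ring_free_algebra)
        (auto simp: free_algebra_simps free_algebra_closed)
    show "subgroup (?J \<inter> carrier (hecke_free n)) (add_monoid (hecke_free n))"
    proof (rule F.add.subgroupI)
      show "?J \<inter> carrier (hecke_free n) \<noteq> {}"
        using additive_subgroup.zero_closed[OF J.additive_subgroup_axioms]
          free_algebra_zero[of "hecke_gens n"] by (auto simp: free_algebra_simps)
      fix q r assume q: "q \<in> ?J \<inter> carrier (hecke_free n)" and r: "r \<in> ?J \<inter> carrier (hecke_free n)"
      show "\<ominus>\<^bsub>hecke_free n\<^esub> q \<in> ?J \<inter> carrier (hecke_free n)"
        using q additive_subgroup.a_inv_closed[OF J.additive_subgroup_axioms, of q] car by (auto simp: neg subset_iff free_algebra_closed)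
      show "q \<oplus>\<^bsub>hecke_free n\<^esub> r \<in> ?J \<inter> carrier (hecke_free n)"
        using q r additive_subgroup.a_closed[OF J.additive_subgroup_axioms, of q r] by (auto simp: free_algebra_simps free_algebra_closed)
    qed auto
  qed (use car J.I_l_closed J.I_r_closed in \<open>auto simp: free_algebra_simps free_algebra_closed\<close>)
  then have "?I \<subseteq> ?J"
    unfolding hecke_ideal_def[of n]
    using ring.genideal_minimal[OF ring_free_algebra _ rel] by blast
  moreover have "a + b \<in> ?J" if "a \<in> ?J" "b \<in> ?J" for a b
    using additive_subgroup.a_closed[OF J.additive_subgroup_axioms that] by (simp add: free_algebra_simps)
  moreover have "0 \<in> ?I"
    using additive_subgroup.zero_closed[OF ideal.axioms(1)[OF ideal_hecke_ideal[of n]]]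
    by (simp add: free_algebra_simps)
  ultimately show ?thesis
    unfolding hecke_incl_def hecke_class_def set_add_def' a_r_coset_def' free_algebra_simps
    by auto
qed

lemma hecke_g_inverse:
  assumes "i \<in> {1..<n}"
  shows "hecke_class n (G i) \<in> Units (hecke n)"
    and "inv\<^bsub>hecke n\<^esub> (hecke_class n (G i)) = hecke_class n (G i - scal (ind_u - inverse ind_u))"
proof -
  interpret ring "hecke n" by (rule ring_hecke)
  interpret h: ring_hom_ring "hecke_free n" "hecke n" "hecke_class n"
    by (intro ring_hom_ringI2 ring_free_algebra ring_hecke hecke_class_hom)
  define c :: free_elt where "c = scal (ind_u - inverse ind_u)"
  have G: "G i \<in> carrier (hecke_free n)"
    using assms by (auto intro!: free_algebra_gen simp: hecke_gens_def)
  have c: "c \<in> carrier (hecke_free n)"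
    by (simp add: c_def free_algebra_scal)
  have comm: "G i * c = c * G i"
    by (simp add: c_def scal_def free_gen_def mult_single)
  have "G i ^ 2 - (1 + c * G i) \<in> hecke_relations n"
    using assms by (auto simp: hecke_relations_def c_def)
  then have rel: "G i ^ 2 - (1 + c * G i) \<in> hecke_ideal n"
    unfolding hecke_ideal_def
    using ring.genideal_self[OF ring_free_algebra hecke_relations_subset] by blast
  have Gc: "G i - c \<in> carrier (hecke_free n)"
    using G c by (rule free_algebra_minus)
  have "G i * (G i - c) - 1 = G i ^ 2 - (1 + c * G i)" "(G i - c) * G i - 1 = G i ^ 2 - (1 + c * G i)"
    using comm by (simp_all add: algebra_simps power2_eq_square)
  with rel have "hecke_class n (G i * (G i - c)) = hecke_class n 1"
    "hecke_class n ((G i - c) * G i) = hecke_class n 1"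
    using G Gc by (metis hecke_class_eq_iff free_algebra_mult free_algebra_one)+
  then have inv: "hecke_class n (G i) \<otimes>\<^bsub>hecke n\<^esub> hecke_class n (G i - c) = \<one>\<^bsub>hecke n\<^esub>"
    "hecke_class n (G i - c) \<otimes>\<^bsub>hecke n\<^esub> hecke_class n (G i) = \<one>\<^bsub>hecke n\<^esub>"
    using h.hom_mult[OF G Gc] h.hom_mult[OF Gc G] h.hom_one by (simp_all add: free_algebra_simps)
  show "hecke_class n (G i) \<in> Units (hecke n)"
    using inv h.hom_closed[OF G] h.hom_closed[OF Gc] by (auto simp: Units_def)
  show "inv\<^bsub>hecke n\<^esub> (hecke_class n (G i)) = hecke_class n (G i - scal (ind_u - inverse ind_u))"
    using inv h.hom_closed[OF G] h.hom_closed[OF Gc] by (intro inv_char) (simp_all add: c_def)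
qed


section \<open>Markov traces\<close>

text \<open>A linear map on the union of the algebras \<open>H\<^sub>n\<close> (\<open>n \<ge> 1\<close>) is given as a family of linear maps
  \<open>\<tau> n\<close> on \<open>H\<^sub>n\<close> that is compatible with the natural maps from \<open>H\<^sub>n\<close> to \<open>H\<^bsub>n+1\<^esub>\<close>. Nothing is
  required of \<open>\<tau> 0\<close>, nor of the values of \<open>\<tau> n\<close> outside \<open>H\<^sub>n\<close>.\<close>

definition hecke_linear :: "nat \<Rightarrow> (free_elt set \<Rightarrow> ratfun) \<Rightarrow> bool" where
  "hecke_linear n f \<longleftrightarrow>
    (\<forall>a \<in> carrier (hecke n). \<forall>b \<in> carrier (hecke n). f (a \<oplus>\<^bsub>hecke n\<^esub> b) = f a + f b) \<and>
    (\<forall>c. \<forall>a \<in> carrier (hecke n). f (hecke_scale n c a) = c * f a)"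

definition markov_trace :: "ratfun \<Rightarrow> ratfun \<Rightarrow> (nat \<Rightarrow> free_elt set \<Rightarrow> ratfun) \<Rightarrow> bool" where
  "markov_trace z y \<tau> \<longleftrightarrow>
    (\<forall>n \<ge> 1.
      hecke_linear n (\<tau> n) \<and>
      (\<forall>a \<in> carrier (hecke n). \<tau> (n + 1) (hecke_incl n a) = \<tau> n a) \<and>
      \<tau> n \<one>\<^bsub>hecke n\<^esub> = 1 \<and>
      (\<forall>a \<in> carrier (hecke n). \<forall>b \<in> carrier (hecke n).
        \<tau> n (a \<otimes>\<^bsub>hecke n\<^esub> b) = \<tau> n (b \<otimes>\<^bsub>hecke n\<^esub> a)) \<and>
      (\<forall>a \<in> carrier (hecke n).
        \<tau> (n + 1) (hecke_incl n a \<otimes>\<^bsub>hecke (n + 1)\<^esub> hecke_class (n + 1) (G n)) = z * \<tau> n a) \<and>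
      (\<forall>a \<in> carrier (hecke n).
        \<tau> (n + 1) (hecke_incl n a \<otimes>\<^bsub>hecke (n + 1)\<^esub> hecke_b (n + 1) (n + 1)) = y * \<tau> n a))"


section \<open>The Temperley-Lieb algebra of type B\<close>

definition g12 :: free_elt where
  "g12 = 1 + scal ind_u * (G 1 + G 2) + scal (ind_u ^ 2) * (G 1 * G 2 + G 2 * G 1)
       + scal (ind_u ^ 3) * (G 1 * G 2 * G 1)"

definition gB :: free_elt where
  "gB = 1 + scal ind_u * G 1 + scal ind_v * B1 + scal (ind_u * ind_v) * (G 1 * B1 + B1 * G 1)
      + scal (ind_u ^ 2 * ind_v) * (G 1 * B1 * G 1) + scal (ind_v ^ 2 * ind_u) * (B1 * G 1 * B1)
      + scal ((ind_u * ind_v) ^ 2) * (G 1 * B1 * G 1 * B1)"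

text \<open>Meant for \<open>n \<ge> 3\<close>, so that both generators lie in \<open>H\<^sub>n\<close>.\<close>

definition TLB_ideal :: "nat \<Rightarrow> free_elt set set" where
  "TLB_ideal n = Idl\<^bsub>hecke n\<^esub> {hecke_class n gB, hecke_class n g12}"

definition TLB :: "nat \<Rightarrow> free_elt set set ring" where
  "TLB n = hecke n Quot TLB_ideal n"

definition passes_to_TLB :: "nat \<Rightarrow> (free_elt set \<Rightarrow> ratfun) \<Rightarrow> bool" where
  "passes_to_TLB n f \<longleftrightarrow> (\<forall>a \<in> TLB_ideal n. f a = 0)"

lemma TLB_ideal_generators:
  assumes "n \<ge> 3"
  shows "hecke_class n gB \<in> carrier (hecke n)" "hecke_class n g12 \<in> carrier (hecke n)"
proof -
  have "B1 \<in> carrier (hecke_free n)" "G 1 \<in> carrier (hecke_free n)" "G 2 \<in> carrier (hecke_free n)"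
    using assms by (auto intro!: free_algebra_gen simp: hecke_gens_def)
  then have "gB \<in> carrier (hecke_free n)" "g12 \<in> carrier (hecke_free n)"
    unfolding gB_def g12_def by (simp_all add: free_algebra_closed)
  then show "hecke_class n gB \<in> carrier (hecke n)" "hecke_class n g12 \<in> carrier (hecke n)"
    by (simp_all add: carrier_hecke)
qed

lemma ideal_TLB_ideal: "n \<ge> 3 \<Longrightarrow> ideal (TLB_ideal n) (hecke n)"
  unfolding TLB_ideal_def
  by (intro ring.genideal_ideal ring_hecke) (auto simp: TLB_ideal_generators)

lemma passes_to_TLB_iff_factors:
  assumes "n \<ge> 3" "hecke_linear n f"
  shows "passes_to_TLB n f \<longleftrightarrow>
    (\<exists>f'. \<forall>a \<in> carrier (hecke n). f a = f' (TLB_ideal n +>\<^bsub>hecke n\<^esub> a))"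
proof -
  interpret ideal "TLB_ideal n" "hecke n" by (rule ideal_TLB_ideal[OF assms(1)])
  have add: "f (a \<oplus>\<^bsub>hecke n\<^esub> b) = f a + f b"
    if "a \<in> carrier (hecke n)" "b \<in> carrier (hecke n)" for a b
    using assms(2) that by (auto simp: hecke_linear_def)
  have zero: "f \<zero>\<^bsub>hecke n\<^esub> = 0"
    using add[of "\<zero>\<^bsub>hecke n\<^esub>" "\<zero>\<^bsub>hecke n\<^esub>"] by (metis add_cancel_right_right r_zero zero_closed)
  show ?thesis
  proof
    assume passes: "passes_to_TLB n f"
    have eq: "f a = f b" if ab: "a \<in> carrier (hecke n)" "b \<in> carrier (hecke n)"
      "TLB_ideal n +>\<^bsub>hecke n\<^esub> a = TLB_ideal n +>\<^bsub>hecke n\<^esub> b" for a b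
    proof -
      have "a \<in> TLB_ideal n +>\<^bsub>hecke n\<^esub> b"
        using a_rcos_self[OF ab(1)] ab(3) by simp
      then obtain j where j: "j \<in> TLB_ideal n" "a = j \<oplus>\<^bsub>hecke n\<^esub> b"
        by (auto simp: a_r_coset_defs)
      then show ?thesis
        using passes ab add[of j b] a_Hcarr[OF j(1)] by (simp add: passes_to_TLB_def)
    qed
    have "f a = f (SOME b. b \<in> carrier (hecke n) \<and>
        TLB_ideal n +>\<^bsub>hecke n\<^esub> b = TLB_ideal n +>\<^bsub>hecke n\<^esub> a)" if "a \<in> carrier (hecke n)" for a
      using that by (intro eq) (rule someI2[of _ a]; simp)+
    then show "\<exists>f'. \<forall>a \<in> carrier (hecke n). f a = f' (TLB_ideal n +>\<^bsub>hecke n\<^esub> a)"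
      by (intro exI[of _ "\<lambda>X. f (SOME b. b \<in> carrier (hecke n) \<and> TLB_ideal n +>\<^bsub>hecke n\<^esub> b = X)"]) simp
  next
    assume "\<exists>f'. \<forall>a \<in> carrier (hecke n). f a = f' (TLB_ideal n +>\<^bsub>hecke n\<^esub> a)"
    then obtain f' where f': "\<And>a. a \<in> carrier (hecke n) \<Longrightarrow> f a = f' (TLB_ideal n +>\<^bsub>hecke n\<^esub> a)"
      by blast
    have "f a = 0" if "a \<in> TLB_ideal n" for a
    proof -
      have "TLB_ideal n +>\<^bsub>hecke n\<^esub> a = TLB_ideal n +>\<^bsub>hecke n\<^esub> \<zero>\<^bsub>hecke n\<^esub>"
        using that quotient_eq_iff_same_a_r_cos[OF ideal_axioms a_Hcarr[OF that] zero_closed]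
        by (simp add: minus_eq a_Hcarr)
      then show ?thesis
        using f'[OF a_Hcarr[OF that]] f'[OF zero_closed] zero by simp
    qed
    then show "passes_to_TLB n f"
      by (simp add: passes_to_TLB_def)
  qed
qed

end

theory Submission
  imports Defs
begin

text \<open>With \<open>J\<close> the Jucys-Murphy element of \<open>H\<^bsub>n+1\<^esub>\<close>, one has
  \<open>H\<^bsub>n+1\<^esub> = H\<^sub>n + H\<^sub>n g\<^sub>n H\<^sub>n + H\<^sub>n J\<close>, and \<open>J - b\<^bsub>n+1\<^esub>\<close> lies in the first two summands. By the
  Markov properties, if \<open>\<tau>(x f) = 0\<close> for all \<open>x \<in> H\<^sub>n\<close> and some \<open>f \<in> H\<^sub>n\<close>, the same holds for all
  \<open>x \<in> H\<^bsub>n+1\<^esub>\<close>. Hence only \<open>\<tau>(x g\<^sub>B)\<close> for \<open>x \<in> H\<^sub>2\<close> and \<open>\<tau>(x g\<^bsub>1,2\<^esub>)\<close> for \<open>x \<in> H\<^sub>3\<close> matter. Both generators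
  are eigenvectors under multiplication by the generators of their parabolic subalgebra, which
  reduces the former to \<open>\<tau>(g\<^sub>B)\<close> and the latter to the double coset representatives
  \<open>1, b\<^sub>1, b\<^sub>1b\<^sub>2, b\<^sub>1b\<^sub>2b\<^sub>3\<close>. The equation \<open>\<tau>(g\<^bsub>1,2\<^esub>) = 0\<close> determines \<open>z\<close>, then \<open>\<tau>(g\<^sub>B) = 0\<close> determines \<open>y\<close>,
  and the remaining expressions vanish for the four resulting pairs.\<close>

section \<open>Algebras with the relations of the Hecke algebra of type B\<close>

text \<open>Scalars act through a central ring homomorphism \<open>s\<close>, so that an algebra
  over \<open>'k\<close> is a type-class ring together with \<open>s\<close>. The family
  \<open>g\<close> starts at index 1; nothing is required of \<open>g 0\<close>.\<close>

locale hecke_type_B =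
  fixes u v :: "'k::field" and s :: "'k \<Rightarrow> 'a::{ring,monoid_mult}" and b :: 'a and g :: "nat \<Rightarrow> 'a"
  assumes s_add: "s (c + d) = s c + s d"
    and s_mult: "s (c * d) = s c * s d"
    and s_one: "s 1 = 1"
    and s_central: "x * s c = s c * x"
    and u_nonzero: "u \<noteq> 0" and v_nonzero: "v \<noteq> 0"
    and g_far: "1 \<le> i \<Longrightarrow> i + 1 < j \<Longrightarrow> g i * g j = g j * g i"
    and g_braid: "1 \<le> i \<Longrightarrow> g i * g (Suc i) * g i = g (Suc i) * g i * g (Suc i)"
    and b_far: "1 < i \<Longrightarrow> b * g i = g i * b"
    and b_braid: "b * g 1 * b * g 1 = g 1 * b * g 1 * b"
    and g_square: "1 \<le> i \<Longrightarrow> g i * g i = 1 + s (u - inverse u) * g i"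
    and b_square: "b * b = 1 + s (v - inverse v) * b"
begin

lemma s_zero: "s 0 = 0"
  using s_add[of 0 0] by simp

lemma s_uminus: "s (- c) = - s c"
  using s_add[of c "- c"] by (simp add: s_zero eq_neg_iff_add_eq_0 add.commute)

lemma s_diff: "s (c - d) = s c - s d"
  using s_add[of c "- d"] by (simp add: s_uminus)

lemma s_left: "x * (s c * w) = s c * (x * w)"
  by (metis mult.assoc s_central)

lemma mult_s_assoc: "s c * (s d * x) = s (c * d) * x"
  by (simp add: s_mult mult.assoc)

text \<open>Instances of centrality that terminate as rewrite rules.\<close>

lemmas s_simps =
  s_central[of b] s_central[of "g i" for i] s_left[of b] s_left[of "g i" for i]
  s_mult[symmetric] s_add[symmetric] mult_s_assoc

definition g_inv :: "nat \<Rightarrow> 'a" where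
  "g_inv i = g i - s (u - inverse u)"

lemma g_inv_cancel:
  assumes "1 \<le> i"
  shows "g i * g_inv i = 1" "g_inv i * g i = 1"
  using g_square[OF assms] by (simp_all add: g_inv_def algebra_simps s_central)

lemma g_inv_cancel_left:
  assumes "1 \<le> i"
  shows "g i * (g_inv i * x) = x" "g_inv i * (g i * x) = x"
  using g_inv_cancel[OF assms] by (metis mult.assoc mult_1_left)+

section \<open>The subalgebras generated by \<open>b\<close> and
  \<open>g_1, ..., g_(n-1)\<close>\<close>

inductive_set H :: "nat \<Rightarrow> 'a set" for n where
  H_scalar: "s c \<in> H n"
| H_add: "x \<in> H n \<Longrightarrow> w \<in> H n \<Longrightarrow> x + w \<in> H n"
| H_mult_b: "x \<in> H n \<Longrightarrow> x * b \<in> H n"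
| H_mult_g: "x \<in> H n \<Longrightarrow> 1 \<le> i \<Longrightarrow> i < n \<Longrightarrow> x * g i \<in> H n"

lemma H_one: "1 \<in> H n"
  using H_scalar[of 1] by (simp add: s_one)

lemma H_b: "b \<in> H n"
  using H_mult_b[OF H_one] by simp

lemma H_g: "1 \<le> i \<Longrightarrow> i < n \<Longrightarrow> g i \<in> H n"
  using H_mult_g[OF H_one] by simp

lemma H_scale: "x \<in> H n \<Longrightarrow> s c * x \<in> H n"
proof (induction rule: H.induct)
  case (H_scalar d)
  then show ?case by (metis s_mult H.H_scalar)
qed (auto simp: distrib_left mult.assoc[symmetric] intro: H.intros)

text \<open>The rules of \<open>H\<close> only append a generator on the right, which keeps
  inductions short; induction on the right factor \<open>w\<close> recovers closure under all
  products.\<close>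

lemma H_mult: "w \<in> H n \<Longrightarrow> x \<in> H n \<Longrightarrow> x * w \<in> H n"
proof (induction rule: H.induct)
  case (H_scalar d)
  then show ?case by (simp add: s_central H_scale)
qed (auto simp: distrib_left mult.assoc[symmetric] intro: H.intros)

lemma H_mono: "x \<in> H n \<Longrightarrow> n \<le> m \<Longrightarrow> x \<in> H m"
  by (induction rule: H.induct) (auto intro: H.intros)

lemma H_uminus: "x \<in> H n \<Longrightarrow> - x \<in> H n"
  using H_scale[of x n "- 1"] by (simp add: s_uminus s_one)

lemma H_diff: "x \<in> H n \<Longrightarrow> w \<in> H n \<Longrightarrow> x - w \<in> H n"
  using H_add[OF _ H_uminus] by fastforce

lemma H_g_inv: "1 \<le> i \<Longrightarrow> i < n \<Longrightarrow> g_inv i \<in> H n"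
  unfolding g_inv_def by (intro H_diff H_g H_scalar)

lemmas H_intros = H_one H_scalar H_b H_g H_g_inv H_add H_diff H_mult

lemma H_commute:
  assumes "x \<in> H n" "w * b = b * w" "\<And>i. 1 \<le> i \<Longrightarrow> i < n \<Longrightarrow> w * g i = g i * w"
  shows "w * x = x * w"
  using assms(1)
proof (induction rule: H.induct)
  case (H_mult_b x)
  then show ?case using assms(2) by (metis mult.assoc)
next
  case (H_mult_g x i)
  then show ?case using assms(3) by (metis mult.assoc)
qed (simp_all add: s_central distrib_left distrib_right)

lemma g_commute_H: "n < m \<Longrightarrow> 1 \<le> n \<Longrightarrow> x \<in> H n \<Longrightarrow> g m * x = x * g m"
  by (rule H_commute) (auto simp: b_far intro!: g_far[symmetric])

text \<open>Indices are shifted by one: \<open>b_conj n\<close> is the element \<open>b\<^bsub>n+1\<^esub>\<close> of the paper, and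
  \<open>jucys n\<close> is the Jucys-Murphy element \<open>g\<^sub>n \<cdots> g\<^sub>1 b\<^sub>1 g\<^sub>1 \<cdots> g\<^sub>n\<close>. Only the latter commutes with all
  of \<open>H n\<close>, so it is used to describe \<open>H (n + 1)\<close>.\<close>

primrec jucys :: "nat \<Rightarrow> 'a" where
  "jucys 0 = b"
| "jucys (Suc n) = g (Suc n) * jucys n * g (Suc n)"

primrec b_conj :: "nat \<Rightarrow> 'a" where
  "b_conj 0 = b"
| "b_conj (Suc n) = g (Suc n) * b_conj n * g_inv (Suc n)"

section \<open>Location and commutation of the Jucys-Murphy elements\<close>

lemma jucys_H: "jucys n \<in> H (Suc n)"
proof (induction n)
  case (Suc n)
  then show ?case using H_mono[of "jucys n" "Suc n" "Suc (Suc n)"] by (auto intro!: H_intros)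
qed (simp add: H_b)

lemma b_conj_H: "b_conj n \<in> H (Suc n)"
proof (induction n)
  case (Suc n)
  then show ?case using H_mono[of "b_conj n" "Suc n" "Suc (Suc n)"] by (auto intro!: H_intros)
qed (simp add: H_b)

text \<open>For \<open>jucys 1\<close> this is the four-term braid relation of type B; all further
  outer factors commute with \<open>b\<close>.\<close>

lemma jucys_commute_b: "jucys n * b = b * jucys n"
proof (induction n)
  case (Suc n)
  show ?case
  proof (cases n)
    case 0
    then show ?thesis using b_braid by (simp add: mult.assoc)
  next
    case (Suc m)
    then have "b * g (Suc n) = g (Suc n) * b" by (simp add: b_far)
    with Suc.IH show ?thesis by (simp only: jucys.simps) (metis mult.assoc)
  qed
qed simp

text \<open>A smaller \<open>g i\<close> commutes with the outermost factors and, by induction, with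
  the inner element. For the top index the braid relation is applied on the right, one factor slides
  through \<open>jucys n\<close>, and the braid relation is applied again on the left.\<close>

lemma jucys_commute_g: "1 \<le> i \<Longrightarrow> i < Suc n \<Longrightarrow> jucys (Suc n) * g i = g i * jucys (Suc n)"
proof (induction n arbitrary: i)
  case 0
  then show ?case by simp
next
  case (Suc n)
  show ?case
  proof (cases "i = Suc n")
    case True
    have br: "g (Suc n) * g (Suc (Suc n)) * g (Suc n) = g (Suc (Suc n)) * g (Suc n) * g (Suc (Suc n))"
      by (rule g_braid) simp
    have "g (Suc (Suc n)) * jucys n = jucys n * g (Suc (Suc n))"
      by (rule g_commute_H[OF _ _ jucys_H]) simp_all
    with br have "g (Suc (Suc n)) * (g (Suc n) * jucys n * g (Suc n)) * g (Suc (Suc n)) * g (Suc n) =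
       g (Suc n) * (g (Suc (Suc n)) * (g (Suc n) * jucys n * g (Suc n)) * g (Suc (Suc n)))"
      by (metis (no_types, opaque_lifting) mult.assoc)
    then show ?thesis by (simp add: True)
  next
    case False
    then have "g i * g (Suc (Suc n)) = g (Suc (Suc n)) * g i" using Suc.prems by (auto intro!: g_far)
    moreover have "jucys (Suc n) * g i = g i * jucys (Suc n)" using Suc False by simp
    ultimately show ?thesis by (simp only: jucys.simps(2)[of "Suc n"]) (metis mult.assoc)
  qed
qed

lemma jucys_commute_H: "x \<in> H n \<Longrightarrow> jucys n * x = x * jucys n"
  by (cases n; rule H_commute) (auto simp: jucys_commute_b jucys_commute_g simp del: jucys.simps)

section \<open>Decomposition of \<open>H (n + 1)\<close> over \<open>H n\<close>\<close>

inductive_set W :: "nat \<Rightarrow> 'a set" for n where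
  W_H: "x \<in> H n \<Longrightarrow> x \<in> W n"
| W_g: "x \<in> H n \<Longrightarrow> w \<in> H n \<Longrightarrow> x * g n * w \<in> W n"
| W_add: "x \<in> W n \<Longrightarrow> w \<in> W n \<Longrightarrow> x + w \<in> W n"

lemma W_mult_right: "x \<in> W n \<Longrightarrow> w \<in> H n \<Longrightarrow> x * w \<in> W n"
proof (induction rule: W.induct)
  case (W_g x w')
  then show ?case using W.W_g[of x n "w' * w"] by (simp add: mult.assoc H_mult)
qed (auto simp: distrib_right intro: W.intros H_mult)

lemma W_mult_left: "x \<in> W n \<Longrightarrow> w \<in> H n \<Longrightarrow> w * x \<in> W n"
proof (induction rule: W.induct)
  case (W_g x w')
  then show ?case using W.W_g[of "w * x" n w'] by (simp add: mult.assoc H_mult)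
qed (auto simp: distrib_left intro: W.intros H_mult)

text \<open>Elements of \<open>H n\<close> commute with \<open>g (Suc n)\<close> and leave its
  square, which the quadratic relation reduces; for \<open>x * g n * w\<close> the braid relation
  makes \<open>g (Suc n)\<close> occur only once.\<close>

lemma g_W_g:
  assumes n: "1 \<le> n"
  shows "x \<in> W n \<Longrightarrow> g (Suc n) * x * g (Suc n) \<in> W (Suc n)"
proof (induction rule: W.induct)
  have H: "x \<in> H (Suc n)" if "x \<in> H n" for x using H_mono[OF that] by simp
  {
    case (W_H x)
    have "g (Suc n) * x * g (Suc n) = x * (g (Suc n) * g (Suc n))"
      using g_commute_H[OF _ n W_H] by (simp add: mult.assoc)
    also have "\<dots> = x + (s (u - inverse u) * x) * g (Suc n) * 1"
      by (simp add: g_square distrib_left s_left[of x] mult.assoc)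
    also have "\<dots> \<in> W (Suc n)"
      using W_H by (intro W.intros H H_one H_scale)
    finally show ?case .
  next
    case (W_g x w)
    have "g (Suc n) * (x * g n * w) * g (Suc n) = (g (Suc n) * x) * (g n * (w * g (Suc n)))"
      by (simp only: mult.assoc)
    also have "\<dots> = x * (g (Suc n) * g n * g (Suc n)) * w"
      unfolding g_commute_H[OF lessI n W_g(1)] g_commute_H[OF lessI n W_g(2), symmetric]
      by (simp only: mult.assoc)
    also have "\<dots> = (x * g n) * g (Suc n) * (g n * w)"
      unfolding g_braid[OF n, symmetric] by (simp only: mult.assoc)
    also have "\<dots> \<in> W (Suc n)"
      using W_g n by (intro W.intros H_mult H H_g) auto
    finally show ?case .
  next
    case (W_add x w)
    then show ?case by (auto simp: distrib_left distrib_right intro: W.intros)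
  }
qed

text \<open>The last factors \<open>g\<close> and \<open>g_inv\<close> differ by a scalar. Passing
  to the next index thus encloses the difference between two factors \<open>g\<close>, as in
  \<open>g_W_g\<close>, and adds a term with a single \<open>g\<close>. This links the Markov rule
  for \<open>b_conj\<close> to the decomposition by \<open>jucys\<close>.\<close>

lemma jucys_minus_b_conj: "jucys (Suc n) - b_conj (Suc n) \<in> W (Suc n)"
proof (induction n)
  case 0
  have "jucys (Suc 0) - b_conj (Suc 0) = (s (u - inverse u) * 1) * g (Suc 0) * b"
    by (simp add: g_inv_def right_diff_distrib s_simps mult.assoc)
  also have "\<dots> \<in> W (Suc 0)" by (intro W.intros H_scale H_one H_b)
  finally show ?case .
next
  case (Suc n)
  have "jucys (Suc (Suc n)) - b_conj (Suc (Suc n)) =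
     g (Suc (Suc n)) * (jucys (Suc n) - b_conj (Suc n)) * g (Suc (Suc n))
     + (s (u - inverse u) * 1) * g (Suc (Suc n)) * b_conj (Suc n)"
    unfolding jucys.simps(2)[of "Suc n"] b_conj.simps(2)[of "Suc n"]
    by (simp add: g_inv_def right_diff_distrib left_diff_distrib s_central[of "b_conj (Suc n)"] s_simps
        mult.assoc s_left[of "b_conj (Suc n)"] del: jucys.simps b_conj.simps)
  also have "\<dots> \<in> W (Suc (Suc n))"
    using Suc by (intro W_add W_g g_W_g H_scale H_one b_conj_H) auto
  finally show ?case .
qed

text \<open>With \<open>W n\<close> standing for \<open>H_n + H_n g_n H_n\<close>, this is the
  candidate for all of \<open>H (n + 1)\<close>. Left coefficients of \<open>jucys n\<close> suffice
  because \<open>jucys n\<close> commutes with \<open>H n\<close>.\<close>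

definition V :: "nat \<Rightarrow> 'a set" where
  "V n = {x + w * jucys n | x w. x \<in> W n \<and> w \<in> H n}"

lemma V_I: "x \<in> W n \<Longrightarrow> w \<in> H n \<Longrightarrow> x + w * jucys n \<in> V n"
  by (auto simp: V_def)

lemma V_add:
  assumes "x \<in> V n" "x' \<in> V n"
  shows "x + x' \<in> V n"
proof -
  obtain p w p' w' where "x = p + w * jucys n" "p \<in> W n" "w \<in> H n"
    "x' = p' + w' * jucys n" "p' \<in> W n" "w' \<in> H n"
    using assms by (auto simp: V_def)
  then show ?thesis
    using V_I[OF W_add[of p n p'] H_add[of w n w']] by (simp add: distrib_right add_ac)
qed

lemma W_V: "x \<in> W n \<Longrightarrow> x \<in> V n"
  using V_I[OF _ H_scalar[of 0 n], of x] by (simp add: s_zero)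

lemma jucys_V: "w \<in> H n \<Longrightarrow> w * jucys n \<in> V n"
  using V_I[OF W_H[OF H_scalar[of 0 n]], of w] by (simp add: s_zero)

lemma V_mult_H:
  assumes "x \<in> V n" "h \<in> H n"
  shows "x * h \<in> V n" "h * x \<in> V n"
proof -
  obtain x' w where x: "x = x' + w * jucys n" "x' \<in> W n" "w \<in> H n"
    using assms(1) by (auto simp: V_def)
  have "x * h = x' * h + (w * h) * jucys n" "h * x = h * x' + (h * w) * jucys n"
    using jucys_commute_H[OF assms(2)] by (simp_all add: x distrib_right distrib_left mult.assoc)
  then show "x * h \<in> V n" "h * x \<in> V n"
    using x(2,3) assms(2) by (simp_all add: V_add W_V jucys_V W_mult_right W_mult_left H_mult)
qed

lemma H_one_eq: "x \<in> H (Suc 0) \<Longrightarrow> \<exists>c d. x = s c + s d * b"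
proof (induction rule: H.induct)
  case (H_scalar c)
  show ?case by (rule exI[of _ c], rule exI[of _ 0]) (simp add: s_zero)
next
  case (H_add x w)
  then obtain c d c' d' where "x = s c + s d * b" "w = s c' + s d' * b" by blast
  then have "x + w = s (c + c') + s (d + d') * b" by (simp add: s_add distrib_right add_ac)
  then show ?case by blast
next
  case (H_mult_b x)
  then obtain c d where "x = s c + s d * b" by blast
  then have "x * b = s d + s (c + d * (v - inverse v)) * b"
    by (simp add: distrib_right distrib_left s_mult s_add mult.assoc b_square)
  then show ?case by blast
qed simp

text \<open>Reduces closure of \<open>V n\<close> under right multiplication by \<open>g n\<close> to its essential cases.\<close>

lemma H_Suc_V_step:
  assumes n: "1 \<le> n" and x: "x \<in> H (Suc n)"
    and g: "\<And>w. w \<in> H n \<Longrightarrow> g n * w * g n \<in> V n" and j: "jucys n * g n \<in> V n"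
  shows "x \<in> V n"
  using x
proof (induction rule: H.induct)
  case (H_scalar c)
  show ?case by (intro W_V W_H H.H_scalar)
next
  case (H_mult_b x)
  then show ?case by (simp add: V_mult_H H_b)
next
  case (H_mult_g x i)
  show ?case
  proof (cases "i = n")
    case False
    then show ?thesis using H_mult_g by (simp add: V_mult_H H_g)
  next
    case True
    have W: "x' * g n \<in> V n" if "x' \<in> W n" for x'
      using that
    proof (induction rule: W.induct)
      case (W_H x)
      then show ?case using W_V[OF W_g[OF W_H H_one]] by simp
    next
      case (W_g x w)
      then show ?case using V_mult_H(2)[OF g[of w], of x] by (simp add: mult.assoc)
    qed (simp add: distrib_right V_add)
    obtain x' w where x: "x = x' + w * jucys n" "x' \<in> W n" "w \<in> H n"
      using H_mult_g(4) by (auto simp: V_def)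
    show ?thesis
      using x V_mult_H(2)[OF j, of w] unfolding True
      by (auto simp: distrib_right mult.assoc intro!: V_add W)
  qed
qed (rule V_add)

text \<open>The quadratic relation turns \<open>g * jucys n * g * g\<close> into
  \<open>g * jucys n\<close> plus a multiple of \<open>jucys (Suc n)\<close>, where \<open>g\<close>
  is \<open>g (Suc n)\<close>.\<close>

lemma jucys_mult_g: "jucys (Suc n) * g (Suc n) \<in> V (Suc n)"
proof -
  have "jucys (Suc n) * g (Suc n) = 1 * g (Suc n) * jucys n + s (u - inverse u) * jucys (Suc n)"
    by (simp add: mult.assoc g_square distrib_left s_simps s_left[of "jucys n"])
  also have "\<dots> \<in> V (Suc n)"
    by (intro V_add W_V W_g jucys_V H_one jucys_H H_scalar)
  finally show ?thesis .
qed

text \<open>The base case uses that \<open>H 1\<close> is spanned by \<open>1\<close> and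
  \<open>b\<close>. In the induction step an element \<open>x + h * jucys (Suc n)\<close> is
  enclosed by two factors \<open>g\<close>: the first summand stays in \<open>W\<close>, while in
  the second \<open>h\<close> moves out and the Jucys-Murphy element becomes the next one.\<close>

lemma H_Suc_V: "x \<in> H (Suc (Suc n)) \<Longrightarrow> x \<in> V (Suc n)"
proof (induction n arbitrary: x)
  case 0
  show ?case
  proof (rule H_Suc_V_step[OF _ 0 _ jucys_mult_g])
    fix w assume "w \<in> H (Suc 0)"
    then obtain c d where w: "w = s c + s d * b" using H_one_eq by blast
    have "g 1 * w * g 1 = s c + s (c * (u - inverse u)) * g 1 * 1 + s d * jucys 1"
      by (simp add: w distrib_left distrib_right mult.assoc s_simps g_square)
    also have "\<dots> \<in> V 1"
      by (intro V_add W_V W_H W_g jucys_V H_one H_scalar)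
    finally show "g (Suc 0) * w * g (Suc 0) \<in> V (Suc 0)" by simp
  qed simp
next
  case (Suc n)
  show ?case
  proof (rule H_Suc_V_step[OF _ Suc.prems _ jucys_mult_g])
    fix w assume "w \<in> H (Suc (Suc n))"
    then obtain x h where w: "w = x + h * jucys (Suc n)" "x \<in> W (Suc n)" "h \<in> H (Suc n)"
      using Suc.IH[of w] unfolding V_def by blast
    have comm: "g (Suc (Suc n)) * h = h * g (Suc (Suc n))"
      using w by (intro g_commute_H[of "Suc n"]) auto
    have "g (Suc (Suc n)) * w * g (Suc (Suc n)) =
        g (Suc (Suc n)) * x * g (Suc (Suc n)) + (g (Suc (Suc n)) * h) * (jucys (Suc n) * g (Suc (Suc n)))"
      unfolding w(1) by (simp only: distrib_left distrib_right mult.assoc)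
    also have "\<dots> =
        g (Suc (Suc n)) * x * g (Suc (Suc n)) + h * jucys (Suc (Suc n))"
      unfolding comm jucys.simps(2)[of "Suc n"] by (simp only: mult.assoc)
    also have "\<dots> \<in> V (Suc (Suc n))"
      using w H_mono[of h "Suc n" "Suc (Suc n)"] by (intro V_add W_V g_W_g jucys_V) auto
    finally show "g (Suc (Suc n)) * w * g (Suc (Suc n)) \<in> V (Suc (Suc n))" .
  qed simp
qed

section \<open>The generators of the ideal as eigenvectors\<close>

lemma g_eigen: "1 \<le> i \<Longrightarrow> g i * (1 + s u * g i) = s u * (1 + s u * g i)"
  and g_eigen_right: "1 \<le> i \<Longrightarrow> (1 + s u * g i) * g i = s u * (1 + s u * g i)"
  \<comment> \<open>The quadratic relation reads \<open>(g_i - u) * (g_i + 1/u) = 0\<close>, and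
    \<open>1 + u * g_i\<close> is \<open>u\<close> times the second factor.\<close>
  using u_nonzero by (simp_all add: distrib_left distrib_right s_simps mult.assoc g_square right_diff_distrib
    s_diff s_one left_diff_distrib)

lemma b_eigen: "b * (1 + s v * b) = s v * (1 + s v * b)"
  using v_nonzero by (simp add: distrib_left distrib_right s_simps mult.assoc b_square right_diff_distrib
    s_diff s_one left_diff_distrib)

text \<open>The sum over the symmetric group \<open>S_3\<close>, weighted by \<open>u\<close> to the
  length. Likewise \<open>gBe\<close> runs over the eight elements of the Weyl group
  \<open>B_2\<close>, with weight \<open>u\<close> for each \<open>g 1\<close> and \<open>v\<close>
  for each \<open>b\<close>.\<close>

definition g12e :: 'a where
  "g12e = 1 + s u * (g 1 + g 2) + s (u ^ 2) * (g 1 * g 2 + g 2 * g 1) + s (u ^ 3) * (g 1 * g 2 * g 1)"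

definition gBe :: 'a where
  "gBe = 1 + s u * g 1 + s v * b + s (u * v) * (g 1 * b + b * g 1)
      + s (u ^ 2 * v) * (g 1 * b * g 1) + s (v ^ 2 * u) * (b * g 1 * b)
      + s ((u * v) ^ 2) * (g 1 * b * g 1 * b)"

lemma braid12: "g 2 * g 1 * g 2 = g 1 * g 2 * g 1"
  using g_braid[of 1] by (simp add: numeral_2_eq_2)

text \<open>Splitting the sum by cosets of the subgroup generated by one reflection leaves
  \<open>1 + u * g_i\<close> as the left or the right factor.\<close>

lemma g12e_factor:
  "g12e = (1 + s u * g 1) * (1 + s u * g 2 + s (u ^ 2) * (g 2 * g 1))"
  "g12e = (1 + s u * g 2) * (1 + s u * g 1 + s (u ^ 2) * (g 1 * g 2))"
  "g12e = (1 + s u * g 2 + s (u ^ 2) * (g 1 * g 2)) * (1 + s u * g 1)"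
  "g12e = (1 + s u * g 1 + s (u ^ 2) * (g 2 * g 1)) * (1 + s u * g 2)"
  using braid12 by (simp_all add: g12e_def distrib_left distrib_right s_simps mult.assoc
    power2_eq_square power3_eq_cube add_ac mult_ac(1))

lemma g12e_eigen:
  assumes "i = 1 \<or> i = 2"
  shows "g i * g12e = s u * g12e" "g12e * g i = s u * g12e"
proof -
  have left: "h * (p * q) = s u * (p * q)" if "h * p = s u * p" for h p q
    using that by (simp add: mult.assoc[symmetric])
  have right: "(q * p) * h = s u * (q * p)" if "p * h = s u * p" for h p q
    using that by (simp add: mult.assoc s_left)
  have "g 1 * g12e = s u * g12e" "g12e * g 1 = s u * g12e"
    unfolding g12e_factor(1) by (rule left[OF g_eigen[OF order_refl]])
      (unfold g12e_factor(1)[symmetric] g12e_factor(3), rule right[OF g_eigen_right[OF order_refl]])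
  moreover have "g 2 * g12e = s u * g12e" "g12e * g 2 = s u * g12e"
    unfolding g12e_factor(2) by (rule left[OF g_eigen[OF one_le_numeral]])
      (unfold g12e_factor(2)[symmetric] g12e_factor(4), rule right[OF g_eigen_right[OF one_le_numeral]])
  ultimately show "g i * g12e = s u * g12e" "g12e * g i = s u * g12e"
    using assms by auto
qed

lemma gBe_factor:
  "gBe = (1 + s u * g 1) * (1 + s v * b + s (u * v) * (b * g 1) + s (u * v ^ 2) * (b * g 1 * b))"
  "gBe = (1 + s v * b) * (1 + s u * g 1 + s (u * v) * (g 1 * b) + s (u ^ 2 * v) * (g 1 * b * g 1))"
  using b_braid by (simp_all add: gBe_def distrib_left distrib_right s_simps mult.assoc
    power2_eq_square add_ac mult_ac)

lemma gBe_eigen: "g 1 * gBe = s u * gBe" "b * gBe = s v * gBe"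
proof -
  show "g 1 * gBe = s u * gBe"
    unfolding gBe_factor(1) mult.assoc[symmetric] g_eigen[OF order_refl] ..
  show "b * gBe = s v * gBe"
    unfolding gBe_factor(2) mult.assoc[symmetric] b_eigen ..
qed

lemma g12e_H: "g12e \<in> H 3"
  unfolding g12e_def by (intro H_intros) auto

lemma gBe_H: "gBe \<in> H 2"
  unfolding gBe_def by (intro H_intros) auto

section \<open>Relations between \<open>g_1\<close>, \<open>g_2\<close> and the conjugates of
  \<open>b\<close>\<close>

lemma g2_b: "g 2 * b = b * g 2"
  by (simp add: b_far)

text \<open>The four-term braid relation solved for \<open>b * g 1 * b\<close>; it exhibits the
  product \<open>b * b_conj 1\<close>, to which the Markov rules apply.\<close>

lemma b_g_b: "b * g 1 * b = g 1 * b * b_conj 1"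
proof -
  have "g 1 * b * b_conj 1 = (g 1 * b * g 1 * b) * g_inv 1"
    by (simp add: mult.assoc)
  also have "\<dots> = b * g 1 * b * (g 1 * g_inv 1)"
    unfolding b_braid[symmetric] by (simp only: mult.assoc)
  finally show ?thesis by (simp add: g_inv_cancel)
qed

lemma g_inv1_g2_g1: "g_inv 1 * g 2 * g 1 = g 2 * g 1 * g_inv 2"
proof -
  have "g_inv 1 * g 2 * g 1 = g_inv 1 * (g 2 * g 1 * g 2) * g_inv 2"
    by (simp add: mult.assoc g_inv_cancel)
  then show ?thesis
    unfolding braid12 by (simp add: mult.assoc g_inv_cancel_left)
qed

lemma g_inv2_g_inv1_g2: "g_inv 2 * g_inv 1 * g 2 = g 1 * g_inv 2 * g_inv 1"
proof -
  have "g 1 * g_inv 2 * g_inv 1 = g_inv 2 * g_inv 1 * (g 1 * g 2 * g 1) * g_inv 2 * g_inv 1"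
    by (simp add: mult.assoc g_inv_cancel_left)
  also have "\<dots> = g_inv 2 * g_inv 1 * g 2"
    unfolding braid12[symmetric] by (simp add: mult.assoc g_inv_cancel_left g_inv_cancel)
  finally show ?thesis ..
qed

lemma g_inv2_b: "g_inv 2 * b = b * g_inv 2"
  by (simp add: g_inv_def right_diff_distrib left_diff_distrib g2_b s_central)

text \<open>The relation \<open>b_g_b\<close> one index higher. It amounts to
  \<open>b_conj 1 * g 2 * b_conj 1\<close> commuting with \<open>g 2\<close>.\<close>

lemma b_conj1_g2_b_conj1: "b_conj 1 * g 2 * b_conj 1 = g 2 * b_conj 1 * b_conj 2"
proof -
  have b_conj2: "b_conj 2 = g 2 * b_conj 1 * g_inv 2"
    by (simp add: numeral_2_eq_2)
  have b_conj1: "b_conj 1 = g 1 * b * g_inv 1"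
    by simp
  \<comment> \<open>This element is the conjugate of \<open>b * g 1 * b\<close> by
    \<open>g 1 * g 2\<close>. Since \<open>b * g 1 * b\<close> commutes with \<open>g 1\<close>, and
    the conjugation carries \<open>g 1\<close> to \<open>g 2\<close>, the commutation with
    \<open>g 2\<close> follows.\<close>
  have mid: "b_conj 1 * g 2 * b_conj 1 = g 1 * g 2 * (b * g 1 * b) * g_inv 2 * g_inv 1"
  proof -
    have "b_conj 1 * g 2 * b_conj 1 = g 1 * b * (g_inv 1 * g 2 * g 1) * b * g_inv 1"
      unfolding b_conj1 by (simp only: mult.assoc)
    also have "\<dots> = g 1 * (b * g 2) * g 1 * (g_inv 2 * b) * g_inv 1"
      unfolding g_inv1_g2_g1 by (simp only: mult.assoc)
    finally show ?thesis
      unfolding g_inv2_b g2_b[symmetric] by (simp only: mult.assoc)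
  qed
  have "g 2 * (b_conj 1 * g 2 * b_conj 1) = (g 2 * g 1 * g 2) * (b * g 1 * b) * g_inv 2 * g_inv 1"
    unfolding mid by (simp only: mult.assoc)
  also have "\<dots> = g 1 * g 2 * (g 1 * b * g 1 * b) * g_inv 2 * g_inv 1"
    unfolding braid12 by (simp only: mult.assoc)
  also have "\<dots> = g 1 * g 2 * (b * g 1 * b) * (g 1 * g_inv 2 * g_inv 1)"
    unfolding b_braid[symmetric] by (simp only: mult.assoc)
  also have "\<dots> = (b_conj 1 * g 2 * b_conj 1) * g 2"
    unfolding g_inv2_g_inv1_g2[symmetric] mid by (simp only: mult.assoc)
  finally have "g 2 * (b_conj 1 * g 2 * b_conj 1) = b_conj 1 * g 2 * b_conj 1 * g 2" .
  then have "g 2 * (b_conj 1 * g 2 * b_conj 1) * g_inv 2 = b_conj 1 * g 2 * b_conj 1"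
    by (simp add: mult.assoc g_inv_cancel del: b_conj.simps)
  then show ?thesis
    by (simp add: b_conj2 mult.assoc del: b_conj.simps)
qed

lemma b_conj1_square: "b_conj 1 * b_conj 1 = 1 + s (v - inverse v) * b_conj 1"
proof -
  have "b_conj 1 * b_conj 1 = g 1 * (b * b) * g_inv 1"
    by (simp add: mult.assoc g_inv_cancel_left)
  also have "\<dots> = 1 + s (v - inverse v) * b_conj 1"
    by (simp add: b_square distrib_left distrib_right s_simps mult.assoc g_inv_cancel)
  finally show ?thesis .
qed

lemma g2_b_conj1_g2: "g 2 * b_conj 1 * g 2 = b_conj 2 + s (u - inverse u) * (g 2 * b_conj 1)"
proof -
  have "b_conj 2 = (g 2 * b_conj 1) * (g 2 - s (u - inverse u))"
    by (simp add: numeral_2_eq_2 g_inv_def)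
  then show ?thesis
    unfolding right_diff_distrib s_central[of "g 2 * b_conj 1"] by (simp add: mult.assoc)
qed

text \<open>By the decomposition of \<open>H 2\<close> over \<open>H 1\<close>, itself spanned by
  \<open>1\<close> and \<open>b\<close>, these eight words span \<open>H 2\<close>. The last two are
  \<open>jucys 1\<close> and \<open>b * jucys 1\<close>.\<close>

lemma H_two_linear_zero:
  fixes f :: "'a \<Rightarrow> 'k"
  assumes add: "\<And>x w. f (x + w) = f x + f w" and scale: "\<And>c x. f (s c * x) = c * f x"
    and zero: "f 1 = 0" "f b = 0" "f (g 1) = 0" "f (b * g 1) = 0" "f (g 1 * b) = 0"
      "f (b * g 1 * b) = 0" "f (g 1 * b * g 1) = 0" "f (b * g 1 * b * g 1) = 0"
    and x: "x \<in> H 2"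
  shows "f x = 0"
proof -
  have H1: "f' x = 0" if "x \<in> H 1" "f' 1 = 0" "f' b = 0"
    "\<And>x w. f' (x + w) = f' x + f' w" "\<And>c x. f' (s c * x) = c * f' x" for x and f' :: "'a \<Rightarrow> 'k"
    using H_one_eq[of x] that(1-3) that(4) that(5)[of _ 1] that(5)[of _ b] by auto
  have mid: "f (x * g 1 * w) = 0" if x: "x \<in> H 1" and w: "w \<in> H 1" for x w
  proof (rule H1[OF x])
    show "f (1 * g 1 * w) = 0"
      by (rule H1[OF w, of "\<lambda>w. f (1 * g 1 * w)"])
        (simp_all add: zero add scale distrib_left s_left del: One_nat_def)
    show "f (b * g 1 * w) = 0"
      by (rule H1[OF w, of "\<lambda>w. f (b * g 1 * w)"])
        (simp_all add: zero add scale distrib_left s_left del: One_nat_def)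
  qed (simp_all add: add scale distrib_right mult.assoc)
  have W: "f x = 0" if "x \<in> W 1" for x
    using that
  proof (induction rule: W.induct)
    case (W_H x)
    then show ?case by (rule H1[of _ f]) (simp_all add: zero add scale)
  qed (simp_all add: mid add del: One_nat_def)
  have J: "f (w * jucys 1) = 0" if "w \<in> H 1" for w
    using that by (rule H1[of _ "\<lambda>w. f (w * jucys 1)"])
      (use zero in \<open>simp_all add: add scale distrib_right mult.assoc\<close>)
  obtain x' w where "x = x' + w * jucys 1" "x' \<in> W 1" "w \<in> H 1"
    using H_Suc_V[of x 0] x by (auto simp: V_def numeral_2_eq_2)
  then show ?thesis using W J by (simp add: add)
qed

end

section \<open>Markov traces\<close>

text \<open>The trace is one function on a ring containing all \<open>H n\<close>, so that no
  inclusion maps occur. As \<open>b_conj n\<close> has index \<open>n + 1\<close> in the usual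
  numbering, both Markov rules lead from \<open>H n\<close> to \<open>H (n + 1)\<close>.\<close>

locale markov_type_B = hecke_type_B u v s b g
  for u v :: "'k::field" and s :: "'k \<Rightarrow> 'a::{ring,monoid_mult}" and b g +
  fixes z y :: 'k and t :: "'a \<Rightarrow> 'k"
  assumes t_add: "t (x + w) = t x + t w"
    and t_scale: "t (s c * x) = c * t x"
    and t_one: "t 1 = 1"
    and t_comm: "t (x * w) = t (w * x)"
    and t_g: "1 \<le> n \<Longrightarrow> x \<in> H n \<Longrightarrow> t (x * g n) = z * t x"
    and t_b_conj: "1 \<le> n \<Longrightarrow> x \<in> H n \<Longrightarrow> t (x * b_conj n) = y * t x"
begin

lemma t_mid: 
  assumes "1 \<le> n" "x \<in> H n" "w \<in> H n"
  shows "t (x * g n * w) = z * t (x * w)"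
proof -
  have "t (x * g n * w) = t ((w * x) * g n)"
    using t_comm[of "x * g n" w] by (simp add: mult.assoc)
  then show ?thesis
    using assms t_comm[of w x] by (simp add: t_g H_mult)
qed

lemma annihilate_Suc:
  assumes n: "1 \<le> n" and f: "f \<in> H n" and zero: "\<And>x. x \<in> H n \<Longrightarrow> t (x * f) = 0"
    and x: "x \<in> H (Suc n)"
  shows "t (x * f) = 0"
proof -
  have W: "t (x * f) = 0" if "x \<in> W n" for x
    using that
  proof (induction rule: W.induct)
    case (W_g x w)
    then show ?case
      using t_mid[OF n W_g(1) H_mult[OF f W_g(2)]] zero[OF H_mult[OF W_g(2,1)]]
      by (simp add: mult.assoc[symmetric])
  qed (simp_all add: zero distrib_right t_add)
  have J: "t (w * jucys n * f) = 0" if w: "w \<in> H n" for w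
  proof -
    obtain m where m: "n = Suc m" using n by (cases n) auto
    \<comment> \<open>As \<open>f\<close> lies in \<open>H n\<close>, it commutes with
      \<open>jucys n\<close>. Cyclicity moves \<open>jucys n - b_conj n\<close> to the front, where
      the case of \<open>W n\<close> applies; the term with \<open>b_conj n\<close> contributes
      \<open>y * t (w * f)\<close>.\<close>
    have "w * jucys n * f = (w * f) * (jucys n - b_conj n) + (w * f) * b_conj n"
      using jucys_commute_H[OF f] by (simp add: mult.assoc right_diff_distrib)
    moreover have "t ((w * f) * (jucys n - b_conj n)) = t ((jucys n - b_conj n) * w * f)"
      using t_comm[of "w * f"] by (simp only: mult.assoc)
    moreover have "(jucys n - b_conj n) * w \<in> W n"
      unfolding m by (rule W_mult_right[OF jucys_minus_b_conj]) (use w m in simp)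
    ultimately show ?thesis
      using W t_b_conj[OF n H_mult[OF f w]] zero[OF w] by (simp add: t_add)
  qed
  obtain x' w where "x = x' + w * jucys n" "x' \<in> W n" "w \<in> H n"
    using H_Suc_V[of x "n - 1"] x n by (auto simp: V_def)
  then show ?thesis using W J by (simp add: distrib_right t_add)
qed

lemma annihilate:
  assumes "1 \<le> m" "f \<in> H m" "\<And>x. x \<in> H m \<Longrightarrow> t (x * f) = 0"
  shows "m \<le> n \<Longrightarrow> x \<in> H n \<Longrightarrow> t (x * f) = 0"
proof (induction n arbitrary: x rule: dec_induct)
  case (step n)
  then show ?case
    using annihilate_Suc[of n f x] assms H_mono[of f m n] by auto
qed (use assms in auto)

section \<open>Explicit values of the trace\<close>

lemma t_g_left: "1 \<le> n \<Longrightarrow> x \<in> H n \<Longrightarrow> t (g n * x) = z * t x"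
  using t_g t_comm by metis

lemma t_square_left:
  assumes "1 \<le> i"
  shows "t (g i * (g i * x)) = t x + (u - inverse u) * t (g i * x)"
proof -
  have "g i * (g i * x) = x + s (u - inverse u) * (g i * x)"
    using g_square[OF assms] by (simp add: mult.assoc[symmetric] distrib_right)
  then show ?thesis by (simp add: t_add t_scale)
qed

text \<open>The rule \<open>t_b_conj\<close> begins with \<open>b_conj 1\<close>, which is a
  conjugate of \<open>b\<close>.\<close>

lemma t_b: "t b = y"
proof -
  have "t (b_conj 1) = t (g_inv 1 * (g 1 * b))"
    using t_comm[of "g 1 * b" "g_inv 1"] by (simp add: mult.assoc)
  moreover have "t (b_conj 1) = y"
    using t_b_conj[of 1 1] by (simp add: H_one t_one del: b_conj.simps)
  ultimately show ?thesis by (simp add: g_inv_cancel_left)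
qed

definition q :: 'k where
  "q = 1 + (v - inverse v) * y"

lemma t_b_square: "t (b * b) = q"
  by (simp add: b_square t_add t_scale t_one t_b q_def)

lemma t_b_b_conj1: "t (b * b_conj 1) = y * y"
  using t_b_conj[of 1 b] by (simp add: H_b t_b del: b_conj.simps)

lemma t_g1_b_b_conj1: "t (g 1 * (b * b_conj 1)) = z * q"
proof -
  have "t (g 1 * (b * b_conj 1)) = t (b * g 1 * b)"
    using b_g_b by (simp only: mult.assoc)
  then show ?thesis
    using t_mid[of 1 b b] by (simp add: H_b t_b_square)
qed

text \<open>In the longest word the two factors \<open>g 1\<close> are brought together by
  \<open>b_g_b\<close>: it equals \<open>g 1 * g 1 * b * b_conj 1\<close>, and the quadratic
  relation applies.\<close>

lemma t_gBe: "t gBe = 1 + u * z + v * y + u * v * (2 * z * y) + u ^ 2 * v * (y + (u - inverse u) * z * y)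
    + v ^ 2 * u * (z * q) + (u * v) ^ 2 * (y * y + (u - inverse u) * (z * q))"
proof -
  have 1: "t (g 1 * b) = z * y"
    using t_g_left[of 1 b] by (simp add: H_b t_b)
  have 2: "t (g 1 * b * g 1) = y + (u - inverse u) * z * y"
    using t_comm[of "g 1 * b" "g 1"] t_square_left[of 1 b] 1 t_b by simp
  have 3: "t (b * g 1 * b) = z * q"
    using t_g1_b_b_conj1 b_g_b by (simp add: mult.assoc del: One_nat_def)
  have "t (g 1 * b * g 1 * b) = t (g 1 * (g 1 * (b * b_conj 1)))"
    using b_g_b by (simp only: mult.assoc)
  then have 4: "t (g 1 * b * g 1 * b) = y * y + (u - inverse u) * (z * q)"
    using t_square_left[of 1 "b * b_conj 1"] t_b_b_conj1 t_g1_b_b_conj1 by (simp del: b_conj.simps One_nat_def)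
  have 5: "t (g 1) = z" "t (b * g 1) = z * y"
    using t_g[of 1 1] t_comm[of b "g 1"] 1 by (simp_all add: H_one t_one)
  show ?thesis
    using 1 2 3 4 5 by (simp add: gBe_def t_add t_scale t_one t_b distrib_left del: One_nat_def)
qed

lemma t_g12e: "t (g12e * x) = t x + u * (t (g 1 * x) + t (g 2 * x))
    + u ^ 2 * (t (g 1 * (g 2 * x)) + t (g 2 * (g 1 * x))) + u ^ 3 * t (g 1 * (g 2 * (g 1 * x)))"
  by (simp add: g12e_def distrib_right mult.assoc t_add t_scale del: One_nat_def)

text \<open>Every word contains \<open>g 2\<close> at most once, between elements of
  \<open>H 2\<close>, so \<open>t_mid\<close> removes it. Since
  \<open>u * (u - inverse u) = u^2 - 1\<close>, both coefficients contain the factor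
  \<open>1 + u * z * (1 + u^2)\<close>.\<close>

lemma t_g12e_H2:
  assumes x: "x \<in> H 2"
  shows "t (g12e * x) = (1 + u * z * (1 + u ^ 2)) * t x
    + u * (1 + 2 * (u * z) + u * z * (u * (u - inverse u))) * t (g 1 * x)"
proof -
  have g1: "g 1 \<in> H 2" by (simp add: H_g)
  have "t (g 2 * x) = z * t x" "t (g 2 * (g 1 * x)) = z * t (g 1 * x)"
    using x g1 by (simp_all add: t_g_left H_mult)
  moreover have "t (g 1 * (g 2 * x)) = z * t (g 1 * x)"
    using t_mid[of 2 "g 1" x] x g1 by (simp add: mult.assoc del: One_nat_def)
  moreover have "t (g 1 * (g 2 * (g 1 * x))) = z * (t x + (u - inverse u) * t (g 1 * x))"
    using t_mid[of 2 "g 1" "g 1 * x"] x g1 t_square_left[of 1 x]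
    by (simp add: mult.assoc H_mult del: One_nat_def)
  ultimately show ?thesis
    by (simp add: t_g12e del: One_nat_def) (simp add: algebra_simps power2_eq_square power3_eq_cube del: One_nat_def)
qed

text \<open>Here \<open>g 1\<close> is removed as well; the resulting factorization is the source of
  the two values of \<open>z\<close>.\<close>

lemma t_g12e_H1:
  assumes x: "x \<in> H 1"
  shows "t (g12e * x) = (1 + u * z) * (1 + u * z * (1 + u ^ 2)) * t x"
proof -
  have "x \<in> H 2" using H_mono[OF x] by simp
  moreover have "t (g 1 * x) = z * t x" using t_g_left[OF order_refl x] .
  moreover have "u * (u - inverse u) = u ^ 2 - 1"
    using u_nonzero by (simp add: right_diff_distrib power2_eq_square)
  ultimately show ?thesis
    by (simp only: t_g12e_H2) (simp add: algebra_simps)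
qed

lemma t_g12e_b_b_conj1: "t (g12e * (b * b_conj 1)) = (1 + u * z * (1 + u ^ 2)) * (y * y)
    + u * (1 + 2 * (u * z) + u * z * (u * (u - inverse u))) * (z * q)"
proof -
  have "b * b_conj 1 \<in> H 2"
    using b_conj_H[of 1] by (intro H_mult H_b) (simp add: numeral_2_eq_2)
  then show ?thesis
    by (simp add: t_g12e_H2 t_b_b_conj1 t_g1_b_b_conj1 del: One_nat_def b_conj.simps)
qed

text \<open>The trace of the third power of \<open>b\<close>, just as \<open>q\<close> is that of
  its square.\<close>

definition r :: 'k where
  "r = y + (v - inverse v) * q"

text \<open>The Markov rule removes \<open>b_conj 2\<close> as long as no \<open>g 2\<close> is
  present. Otherwise \<open>g 2 * b_conj 1 * b_conj 2\<close> is usually rewritten as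
  \<open>b_conj 1 * g 2 * b_conj 1\<close>, and \<open>t_mid\<close> removes
  \<open>g 2\<close>.\<close>

lemma t_g12e_b_b_conj1_b_conj2: "t (g12e * (b * (b_conj 1 * b_conj 2))) = y * (y * y) + u * (2 * (y * (z * q)))
    + u ^ 2 * (2 * (z * (z * r))) + u ^ 3 * (y * (z * q) + (u - inverse u) * (z * (z * r)))"
proof -
  note [simp del] = One_nat_def b_conj.simps
  have H2: "g 1 \<in> H 2" "b \<in> H 2" "b_conj 1 \<in> H 2"
    using b_conj_H[of 1] by (simp_all add: H_g H_b numeral_2_eq_2)
  have braid: "x * (g 2 * (b_conj 1 * b_conj 2)) = x * (b_conj 1 * (g 2 * b_conj 1))" for x
    using b_conj1_g2_b_conj1 by (simp only: mult.assoc)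
  have sq: "x * (b_conj 1 * b_conj 1) = x + s (v - inverse v) * (x * b_conj 1)" for x
    unfolding b_conj1_square by (simp add: distrib_left s_left[of x])
  have mid: "t (x * g 2 * w) = z * t (x * w)" if "x \<in> H 2" "w \<in> H 2" for x w
    using t_mid[of 2 x w] that by simp
  have 0: "t (b * (b_conj 1 * b_conj 2)) = y * (y * y)"
    using t_b_conj[of 2 "b * b_conj 1"] H2 by (simp add: H_mult mult.assoc t_b_b_conj1)
  have 1: "t (g 1 * (b * (b_conj 1 * b_conj 2))) = y * (z * q)"
    using t_b_conj[of 2 "g 1 * (b * b_conj 1)"] H2 by (simp add: H_mult mult.assoc t_g1_b_b_conj1)
  have 2: "t (g 2 * (b * (b_conj 1 * b_conj 2))) = y * (z * q)"
  proof -
    have "g 2 * (b * (b_conj 1 * b_conj 2)) = (b * b_conj 1) * g 2 * b_conj 1"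
      using g2_b braid[of b] by (metis mult.assoc)
    then have "t (g 2 * (b * (b_conj 1 * b_conj 2))) = z * t (b * (b_conj 1 * b_conj 1))"
      using mid[of "b * b_conj 1" "b_conj 1"] H2 by (simp add: H_mult mult.assoc)
    then show ?thesis
      by (simp add: sq t_add t_scale t_b t_b_b_conj1 q_def algebra_simps)
  qed
  have core: "t ((g 1 * (b * b_conj 1)) * g 2 * b_conj 1) = z * (z * r)"
  proof -
    have "t ((g 1 * (b * b_conj 1)) * g 2 * b_conj 1) = z * t ((g 1 * b) * (b_conj 1 * b_conj 1))"
      using mid[of "g 1 * (b * b_conj 1)" "b_conj 1"] H2 by (simp add: H_mult mult.assoc)
    also have "\<dots> = z * (t (g 1 * b) + (v - inverse v) * t (g 1 * (b * b_conj 1)))"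
      unfolding sq by (simp add: t_add t_scale mult.assoc)
    also have "t (g 1 * b) = z * y"
      using t_g_left[of 1 b] by (simp add: H_b t_b)
    finally show ?thesis
      by (simp add: t_g1_b_b_conj1 r_def algebra_simps)
  qed
  have 3: "t (g 1 * (g 2 * (b * (b_conj 1 * b_conj 2)))) = z * (z * r)"
  proof -
    have "g 1 * (g 2 * (b * (b_conj 1 * b_conj 2))) = (g 1 * (b * b_conj 1)) * g 2 * b_conj 1"
      using g2_b braid[of b] by (metis mult.assoc)
    then show ?thesis using core by simp
  qed
  have b_conj2: "b_conj 2 = g 2 * b_conj 1 * g_inv 2"
    by (simp add: numeral_2_eq_2 b_conj.simps One_nat_def)
  \<comment> \<open>The leading \<open>g 2\<close> is cancelled by the \<open>g_inv 2\<close> at the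
    end of \<open>b_conj 2\<close>, brought round by cyclicity.\<close>
  have 4: "t (g 2 * (g 1 * (b * (b_conj 1 * b_conj 2)))) = z * (z * r)"
  proof -
    have "t (g 2 * (g 1 * (b * (b_conj 1 * b_conj 2)))) = t ((g 2 * (g 1 * (b * b_conj 1)) * g 2 * b_conj 1) * g_inv 2)"
      unfolding b_conj2 by (simp only: mult.assoc)
    also have "\<dots> = t (g_inv 2 * (g 2 * (g 1 * (b * b_conj 1)) * g 2 * b_conj 1))"
      by (rule t_comm)
    also have "\<dots> = t ((g 1 * (b * b_conj 1)) * g 2 * b_conj 1)"
      by (simp add: mult.assoc g_inv_cancel_left)
    finally show ?thesis using core by simp
  qed
  \<comment> \<open>The braid relation gives outer factors \<open>g 2\<close>. The right one is
    absorbed as before; the left one is rotated to the end, where \<open>g2_b_conj1_g2\<close>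
    reduces to values already found.\<close>
  have 5: "t (g 1 * (g 2 * (g 1 * (b * (b_conj 1 * b_conj 2))))) = y * (z * q) + (u - inverse u) * (z * (z * r))"
  proof -
    let ?w = "g 1 * (b * b_conj 1)"
    have "g 1 * (g 2 * (g 1 * (b * (b_conj 1 * b_conj 2)))) = (g 2 * g 1 * g 2) * (b * (b_conj 1 * b_conj 2))"
      unfolding braid12 by (simp only: mult.assoc)
    also have "\<dots> = g 2 * g 1 * ((g 2 * b) * (b_conj 1 * b_conj 2))"
      by (simp only: mult.assoc)
    also have "\<dots> = g 2 * (?w * g 2 * b_conj 1)"
      unfolding g2_b using braid[of b] by (simp only: mult.assoc)
    finally have "t (g 1 * (g 2 * (g 1 * (b * (b_conj 1 * b_conj 2))))) = t ((?w * g 2 * b_conj 1) * g 2)"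
      using t_comm by metis
    also have "\<dots> = t (?w * (g 2 * b_conj 1 * g 2))"
      by (simp only: mult.assoc)
    also have "\<dots> = t (?w * b_conj 2) + (u - inverse u) * t (?w * g 2 * b_conj 1)"
      unfolding g2_b_conj1_g2 distrib_left s_left[of ?w] t_add t_scale by (simp only: mult.assoc)
    finally show ?thesis using 1 core by (simp add: mult.assoc)
  qed
  show ?thesis
    by (simp add: t_g12e 0 1 2 3 4 5)
qed

text \<open>The functional \<open>x -> t (x * g12e)\<close> gains a factor \<open>u\<close> when
  \<open>x\<close> is multiplied by \<open>g 1\<close> or \<open>g 2\<close> on either side, on the
  left by cyclicity. Stripping such factors from spanning words of the three summands of
  \<open>H 3\<close> leaves the four given representatives.\<close>

lemma annihilate_g12e:
  assumes zero: "t (g12e * 1) = 0" "t (g12e * b) = 0" "t (g12e * (b * b_conj 1)) = 0"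
      "t (g12e * (b * (b_conj 1 * b_conj 2))) = 0"
    and x: "x \<in> H 3"
  shows "t (x * g12e) = 0"
proof -
  note [simp del] = One_nat_def b_conj.simps jucys.simps
  define L where "L x = t (x * g12e)" for x
  have add: "L (x + w) = L x + L w" and scale: "L (s c * x) = c * L x" for x w c
    by (simp_all add: L_def distrib_right t_add t_scale mult.assoc)
  have right: "L (x * g i) = u * L x" if "i = 1 \<or> i = 2" for x i
    using g12e_eigen(1)[OF that] s_left[of x] by (simp add: L_def mult.assoc t_scale)
  have left: "L (g i * x) = u * L x" if "i = 1 \<or> i = 2" for x i
  proof -
    have "L (g i * x) = t ((x * g12e) * g i)"
      unfolding L_def using t_comm[of "g i"] by (simp add: mult.assoc)
    also have "\<dots> = u * L x"
      using g12e_eigen(2)[OF that] s_left[of x] by (simp add: L_def mult.assoc t_scale)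
    finally show ?thesis .
  qed
  note right1 = right[of 1, simplified] and right2 = right[of 2, simplified]
    and left1 = left[of 1, simplified] and left2 = left[of 2, simplified]
  have L1: "L 1 = 0" and Lb: "L b = 0" and Lbb: "L (b * b_conj 1) = 0" and Lbbb: "L (b * (b_conj 1 * b_conj 2)) = 0"
    using zero t_comm[of _ g12e] by (simp_all add: L_def)
  have bgb: "b * g 1 * b = b * b_conj 1 * g 1"
    by (simp add: b_conj.simps mult.assoc g_inv_cancel One_nat_def)
  have Lbgb: "L (b * g 1 * b) = 0"
    unfolding bgb right1 Lbb by simp
  have b_conj2: "b_conj 2 = g 2 * b_conj 1 * g_inv 2"
    by (simp add: numeral_2_eq_2 b_conj.simps One_nat_def)
  \<comment> \<open>The irreducible word with three factors \<open>b\<close>: it equals the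
    representative \<open>b * b_conj 1 * b_conj 2\<close> times
    \<open>g 2 * g 1 * g 2\<close>.\<close>
  have "b * g 1 * b * g 2 * g 1 * b = b * b_conj 1 * (g 1 * g 2 * g 1) * b"
    unfolding bgb by (simp only: mult.assoc)
  also have "\<dots> = b * b_conj 1 * g 2 * g 1 * (g 2 * b)"
    unfolding braid12[symmetric] by (simp only: mult.assoc)
  also have "\<dots> = b * b_conj 1 * g 2 * b_conj 1 * g 1 * g 2"
    unfolding g2_b by (simp add: b_conj.simps mult.assoc g_inv_cancel One_nat_def g_inv_cancel_left)
  also have "\<dots> = b * (b_conj 1 * b_conj 2) * g 2 * g 1 * g 2"
    by (simp add: b_conj2 mult.assoc g_inv_cancel_left)
  finally have Lbgbgb: "L (b * g 1 * b * g 2 * g 1 * b) = 0"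
    by (simp add: right1 right2 Lbbb)
  have L_H2: "L x = 0" if x: "x \<in> H 2" for x
  proof (rule H_two_linear_zero[OF add scale _ _ _ _ _ _ _ _ x])
    show "L (g 1) = 0" using right1[of 1] L1 by simp
  qed (simp_all add: L1 Lb Lbgb right1 left1)
  have b_H2: "b * x \<in> H 2" if "x \<in> H 2" for x
    using that by (intro H_mult H_b)
  \<comment> \<open>In the summand \<open>H_2 g_2 H_2\<close>, the left coefficient
    \<open>b * g 1\<close> is the essential one: the others reduce to it or to \<open>H 2\<close> by
    stripping \<open>g 1\<close> and \<open>g 2\<close> and moving \<open>b\<close> past
    \<open>g 2\<close>.\<close>
  have C: "L (b * g 1 * g 2 * w) = 0" if w: "w \<in> H 2" for w
  proof (rule H_two_linear_zero[of "\<lambda>w. L (b * g 1 * g 2 * w)", OF _ _ _ _ _ _ _ _ _ _ w])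
    have 1: "b * g 1 * g 2 * b = b * g 1 * b * g 2"
      using g2_b by (simp add: mult.assoc)
    have 2: "b * g 1 * g 2 * (g 1 * b) = g 2 * (b * g 1 * b) * g 2"
    proof -
      have "b * g 1 * g 2 * (g 1 * b) = b * (g 1 * g 2 * g 1) * b" by (simp only: mult.assoc)
      also have "\<dots> = (b * g 2) * g 1 * (g 2 * b)" unfolding braid12[symmetric] by (simp only: mult.assoc)
      also have "\<dots> = g 2 * (b * g 1 * b) * g 2" unfolding g2_b
        by (subst g2_b[symmetric]) (simp only: mult.assoc)
      finally show ?thesis .
    qed
    have 3: "b * g 1 * g 2 * (b * g 1 * b) = b * g 1 * b * g 2 * g 1 * b"
      using g2_b by (simp add: mult.assoc) (metis mult.assoc)
    show c1: "L (b * g 1 * g 2 * 1) = 0" by (simp add: right1 right2 Lb)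
    show cb: "L (b * g 1 * g 2 * b) = 0" unfolding 1 by (simp add: right2 Lbgb)
    show cgb: "L (b * g 1 * g 2 * (g 1 * b)) = 0" unfolding 2 by (simp add: right2 left2 Lbgb)
    show cbgb: "L (b * g 1 * g 2 * (b * g 1 * b)) = 0" unfolding 3 by (rule Lbgbgb)
    have r: "L (b * g 1 * g 2 * (w * g 1)) = u * L (b * g 1 * g 2 * w)" for w
      using right1[of "b * g 1 * g 2 * w"] by (simp add: mult.assoc)
    show "L (b * g 1 * g 2 * g 1) = 0" using c1 by (simp add: right1)
    show "L (b * g 1 * g 2 * (b * g 1)) = 0" "L (b * g 1 * g 2 * (g 1 * b * g 1)) = 0"
      "L (b * g 1 * g 2 * (b * g 1 * b * g 1)) = 0"
      unfolding r cb cgb cbgb by simp_all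
  qed (simp_all add: add scale distrib_left s_left)
  have D: "L (x * g 2 * w) = 0" if x: "x \<in> H 2" and w: "w \<in> H 2" for x w
  proof (rule H_two_linear_zero[of "\<lambda>x. L (x * g 2 * w)", OF _ _ _ _ _ _ _ _ _ _ x])
    have l: "L (g 1 * x * g 2 * w) = u * L (x * g 2 * w)" for x
      using left1[of "x * g 2 * w"] by (simp add: mult.assoc)
    show c1: "L (1 * g 2 * w) = 0" by (simp add: left2 L_H2[OF w])
    have "L (b * g 2 * w) = L (g 2 * (b * w))" by (simp only: g2_b[symmetric] mult.assoc)
    then show cb: "L (b * g 2 * w) = 0" by (simp add: left2 L_H2[OF b_H2[OF w]])
    show "L (g 1 * g 2 * w) = 0" using l[of 1] c1 by simp
    show cbg: "L (b * g 1 * g 2 * w) = 0" by (rule C[OF w])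
    show "L (g 1 * b * g 2 * w) = 0" using l[of b] cb by simp
    have "b * g 1 * b * g 2 * w = b * g 1 * g 2 * (b * w)"
      by (metis g2_b mult.assoc)
    then show cbgb: "L (b * g 1 * b * g 2 * w) = 0" using C[OF b_H2[OF w]] by simp
    show "L (g 1 * b * g 1 * g 2 * w) = 0"
      using l[of "b * g 1"] cbg by (simp add: mult.assoc)
    show "L (b * g 1 * b * g 1 * g 2 * w) = 0"
      unfolding b_braid using l[of "b * g 1 * b"] cbgb by (simp add: mult.assoc)
  qed (simp_all add: add scale distrib_right mult.assoc)
  \<comment> \<open>Coefficients of \<open>jucys 2\<close> can be stripped of \<open>g 1\<close> on
    both sides, on the right because \<open>jucys 2\<close> commutes with
    \<open>g 1\<close>.\<close>
  have J: "L (x * jucys 2) = 0" if x: "x \<in> H 2" for x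
  proof (rule H_two_linear_zero[of "\<lambda>x. L (x * jucys 2)", OF _ _ _ _ _ _ _ _ _ _ x])
    have jucys: "jucys 2 = g 2 * g 1 * b * g 1 * g 2"
      by (simp add: numeral_2_eq_2 jucys.simps mult.assoc One_nat_def)
    have r: "L (x * g 1 * jucys 2) = u * L (x * jucys 2)" for x
      using right1[of "x * jucys 2"] jucys_commute_H[of "g 1" 2] by (simp add: H_g mult.assoc)
    have l: "L (g 1 * x * jucys 2) = u * L (x * jucys 2)" for x
      using left1[of "x * jucys 2"] by (simp add: mult.assoc)
    have "1 * jucys 2 = g 2 * (g 1 * (b * g 1 * g 2))"
      by (simp add: jucys mult.assoc)
    then show c1: "L (1 * jucys 2) = 0"
      by (simp only: left2 left1 right1 right2 Lb mult_zero_right)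
    have "b * jucys 2 = (b * g 2) * (g 1 * b * g 1 * g 2)"
      unfolding jucys by (simp only: mult.assoc)
    also have "\<dots> = g 2 * (b * g 1 * b * g 1 * g 2)"
      unfolding g2_b[symmetric] by (simp only: mult.assoc)
    finally show cb: "L (b * jucys 2) = 0" by (simp add: left2 right1 right2 Lbgb)
    have "b * g 1 * b * jucys 2 = b * g 1 * b * g 2 * g 1 * b * g 1 * g 2"
      unfolding jucys by (simp only: mult.assoc)
    then show cbgb: "L (b * g 1 * b * jucys 2) = 0" by (simp add: right1 right2 Lbgbgb)
    show "L (g 1 * jucys 2) = 0" using l[of 1] c1 by simp
    show "L (b * g 1 * jucys 2) = 0" "L (b * g 1 * b * g 1 * jucys 2) = 0" unfolding r cb cbgb by simp_all
    show gb: "L (g 1 * b * jucys 2) = 0" unfolding l cb by simp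
    show "L (g 1 * b * g 1 * jucys 2) = 0" unfolding r gb by simp
  qed (simp_all add: add scale distrib_right mult.assoc)
  have W: "L x = 0" if "x \<in> W 2" for x
    using that by (induction rule: W.induct) (simp_all add: L_H2 D add)
  obtain x' w where "x = x' + w * jucys 2" "x' \<in> W 2" "w \<in> H 2"
    using H_Suc_V[of x 1] x by (auto simp: V_def numeral_3_eq_3 numeral_2_eq_2 One_nat_def)
  then have "L x = 0" by (simp add: add W J)
  then show ?thesis by (simp add: L_def)
qed

lemma annihilate_gBe:
  assumes zero: "t gBe = 0" and x: "x \<in> H 2"
  shows "t (x * gBe) = 0"
  using x
proof (induction rule: H.induct)
  case (H_scalar c)
  then show ?case by (simp add: t_scale zero)
next
  case (H_mult_b x)
  then show ?case by (simp add: mult.assoc gBe_eigen s_left[of x] t_scale)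
next
  case (H_mult_g x i)
  then have "i = 1" by simp
  with H_mult_g gBe_eigen(1) show ?case by (simp add: mult.assoc s_left[of x] t_scale)
qed (simp add: distrib_right t_add)


section \<open>Solving for \<open>z\<close> and \<open>y\<close>\<close>

lemma t_g12e_zero_iff: "t g12e = 0 \<longleftrightarrow> u * z = - 1 \<or> u * z * (1 + u ^ 2) = - 1"
proof -
  have "t g12e = (1 + u * z) * (1 + u * z * (1 + u ^ 2))"
    using t_g12e_H1[OF H_one] by (simp add: t_one)
  then show ?thesis by (simp add: add_eq_0_iff eq_commute[of _ "- 1"])
qed

lemma q_mult_v: "v * q = v + (v ^ 2 - 1) * y"
  using v_nonzero by (simp add: q_def field_simps power2_eq_square)

text \<open>Naming \<open>u - inverse u\<close> keeps \<open>inverse\<close> out of the polynomial identities below; the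
  method is qualified because HOL-Algebra has another \<open>algebra\<close>.\<close>

lemma u_diff_inverse: obtains c where "u - inverse u = c" "u * c = u ^ 2 - 1"
  using u_nonzero by (simp add: right_diff_distrib power2_eq_square)

text \<open>For this \<open>z\<close> the trace collapses to a multiple of \<open>y * y - q\<close>;
  its vanishing says that \<open>y\<close> satisfies the quadratic relation of \<open>b\<close>,
  with roots \<open>v\<close> and \<open>- 1/v\<close>.\<close>

lemma t_gBe_case1:
  assumes "u * z = - 1"
  shows "t gBe = 0 \<longleftrightarrow> v * y = - 1 \<or> y = v"
proof -
  obtain c where c: "u - inverse u = c" "u * c = u ^ 2 - 1" by (rule u_diff_inverse)
  have "t gBe = u ^ 2 * v ^ 2 * (y * y - q)"
    unfolding t_gBe c(1) using assms c(2) by Groebner_Basis.algebra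
  moreover have "v * (y * y - q) = (v * y + 1) * (y - v)"
    using q_mult_v by Groebner_Basis.algebra
  ultimately have "t gBe = 0 \<longleftrightarrow> (v * y + 1) * (y - v) = 0"
    using u_nonzero v_nonzero by (metis mult_eq_0_iff power_not_zero)
  then show ?thesis
    by (simp only: mult_eq_0_iff eq_neg_iff_add_eq_0 right_minus_eq)
qed

text \<open>Multiplication by \<open>1 + u^2\<close> eliminates \<open>z\<close>; the remaining
  quadratic polynomial in \<open>y\<close> splits into two linear factors.\<close>

lemma t_gBe_case2:
  assumes "u * z * (1 + u ^ 2) = - 1" "1 + u ^ 2 \<noteq> 0"
  shows "t gBe = 0 \<longleftrightarrow> v * y = - 1 \<or> (1 + u ^ 2) * v * y = v ^ 2 - 1"
proof -
  obtain c where c: "u - inverse u = c" "u * c = u ^ 2 - 1" by (rule u_diff_inverse)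
  have "(1 + u ^ 2) * t gBe = u ^ 2 * ((v * y + 1) * ((1 + u ^ 2) * v * y - (v ^ 2 - 1)))"
    unfolding t_gBe c(1) using assms(1) c(2) q_mult_v by Groebner_Basis.algebra
  then have "t gBe = 0 \<longleftrightarrow> (v * y + 1) * ((1 + u ^ 2) * v * y - (v ^ 2 - 1)) = 0"
    using u_nonzero assms(2) by (metis mult_eq_0_iff power_not_zero)
  then show ?thesis
    by (simp only: mult_eq_0_iff eq_neg_iff_add_eq_0 right_minus_eq)
qed

text \<open>The trace equals \<open>(1 + u * z * (1 + u^2)) * (y * y + u * z * q)\<close>. For
  \<open>u * z = - 1\<close> the second factor is \<open>y * y - q\<close>, which vanishes together
  with \<open>t gBe\<close>; for the other value of \<open>z\<close> the first factor is
  zero.\<close>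

lemma t_g12e_b_b_conj1_zero:
  assumes "t g12e = 0" "t gBe = 0"
  shows "t (g12e * (b * b_conj 1)) = 0"
proof -
  obtain c where c: "u - inverse u = c" "u * c = u ^ 2 - 1" by (rule u_diff_inverse)
  show ?thesis
  proof (cases "u * z = - 1")
    case True
    have yq: "y * y = q"
      using t_gBe_case1[OF True] assms(2) q_mult_v v_nonzero by Groebner_Basis.algebra
    have "t (g12e * (b * b_conj 1)) = (1 + u * z * (1 + u ^ 2)) * (y * y)
        + u * z * (1 + 2 * (u * z) + u * z * (u * c)) * q"
      unfolding t_g12e_b_b_conj1 c(1) by (simp add: mult_ac)
    then show ?thesis
      unfolding True c(2) yq by (simp add: algebra_simps)
  next
    case False
    then have "u * z * (1 + u ^ 2) = - 1" using assms(1) t_g12e_zero_iff by blast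
    then show ?thesis
      unfolding t_g12e_b_b_conj1 c(1) using c(2) by Groebner_Basis.algebra
  qed
qed

text \<open>For \<open>u * z = - 1\<close> one has \<open>y * y = q\<close>, hence
  \<open>y * q = r\<close>, and all terms cancel. For the other \<open>z\<close>, the trace times
  \<open>v^2 * (1 + u^2)\<close> is a product containing both linear factors from
  \<open>t_gBe_case2\<close>.\<close>

lemma t_g12e_b_b_conj1_b_conj2_zero:
  assumes "t g12e = 0" "t gBe = 0" "1 + u ^ 2 \<noteq> 0"
  shows "t (g12e * (b * (b_conj 1 * b_conj 2))) = 0"
proof -
  obtain c where c: "u - inverse u = c" "u * c = u ^ 2 - 1" by (rule u_diff_inverse)
  have vr: "v * r = v * y + (v ^ 2 - 1) * q"
    using v_nonzero by (simp add: r_def field_simps power2_eq_square)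
  show ?thesis
  proof (cases "u * z = - 1")
    case True
    have yq: "y * y = q"
      using t_gBe_case1[OF True] assms(2) q_mult_v v_nonzero by Groebner_Basis.algebra
    have "v * (y * q) = y * (v + (v ^ 2 - 1) * y)"
      unfolding q_mult_v[symmetric] by (simp only: mult_ac)
    also have "\<dots> = v * y + (v ^ 2 - 1) * (y * y)"
      by (simp add: algebra_simps)
    also have "\<dots> = v * r"
      unfolding yq vr ..
    finally have yr: "y * q = r" using v_nonzero by simp
    have "t (g12e * (b * (b_conj 1 * b_conj 2))) = y * (y * y) + 2 * (u * z) * (y * q)
        + 2 * (u * z) ^ 2 * r + u ^ 2 * (u * z) * (y * q) + (u * z) ^ 2 * (u * c) * r"
      unfolding t_g12e_b_b_conj1_b_conj2 c(1) by (simp add: algebra_simps power2_eq_square power3_eq_cube)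
    then show ?thesis
      unfolding True c(2) yq yr by (simp add: algebra_simps)
  next
    case False
    then have uz: "u * z * (1 + u ^ 2) = - 1" using assms(1) t_g12e_zero_iff by blast
    have "(1 + u ^ 2) * t (g12e * (b * (b_conj 1 * b_conj 2)))
        = (1 + u ^ 2) * (y * (y * y)) - (2 + u ^ 2) * (y * q) + r"
      unfolding t_g12e_b_b_conj1_b_conj2 c(1) using uz c(2) by Groebner_Basis.algebra
    moreover have "v ^ 2 * ((1 + u ^ 2) * (y * (y * y)) - (2 + u ^ 2) * (y * q) + r)
        = (v * y + 1) * (y - v) * ((1 + u ^ 2) * v * y - (v ^ 2 - 1))"
      using vr q_mult_v by Groebner_Basis.algebra
    moreover have "(v * y + 1) * ((1 + u ^ 2) * v * y - (v ^ 2 - 1)) = 0"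
      using t_gBe_case2[OF uz assms(3)] assms(2) by auto
    ultimately show ?thesis
      using v_nonzero assms(3) by (metis mult_eq_0_iff power_not_zero)
  qed
qed

lemma vanishing_iff:
  assumes n: "3 \<le> n" and u: "1 + u ^ 2 \<noteq> 0"
  shows "(\<forall>x \<in> H n. t (x * gBe) = 0 \<and> t (x * g12e) = 0) \<longleftrightarrow>
      (z = - 1 / u \<and> y = - 1 / v) \<or>
      (z = - 1 / u \<and> y = v) \<or>
      (z = - 1 / (u * (1 + u ^ 2)) \<and> y = - 1 / v) \<or>
      (z = - 1 / (u * (1 + u ^ 2)) \<and> y = (- 1 + v ^ 2) / ((1 + u ^ 2) * v))"
    (is "?van \<longleftrightarrow> ?vals")
proof -
  have "?van \<longleftrightarrow> t g12e = 0 \<and> t gBe = 0"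
  proof
    assume ?van
    from bspec[OF this H_one] show "t g12e = 0 \<and> t gBe = 0" by simp
  next
    assume zero: "t g12e = 0 \<and> t gBe = 0"
    have "t (g12e * b) = 0"
      using t_g12e_H1[OF H_b] t_g12e_H1[OF H_one] zero by (simp add: t_one)
    then have "t (x * g12e) = 0" if "x \<in> H 3" for x
      using zero u that by (intro annihilate_g12e) (simp_all add: t_g12e_b_b_conj1_zero t_g12e_b_b_conj1_b_conj2_zero
        del: b_conj.simps One_nat_def)
    then have "t (x * g12e) = 0" if "x \<in> H n" for x
      using annihilate[OF _ g12e_H _ n that] by simp
    moreover have "t (x * gBe) = 0" if "x \<in> H n" for x
      using annihilate[OF _ gBe_H _ _ that] n zero by (simp add: annihilate_gBe)
    ultimately show ?van by blast
  qed
  also have "\<dots> \<longleftrightarrow> (u * z = - 1 \<and> (v * y = - 1 \<or> y = v))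
      \<or> (u * z * (1 + u ^ 2) = - 1 \<and> (v * y = - 1 \<or> (1 + u ^ 2) * v * y = v ^ 2 - 1))"
    using t_g12e_zero_iff t_gBe_case1 t_gBe_case2[OF _ u] by blast
  also have "u * z = - 1 \<longleftrightarrow> z = - 1 / u"
    by (simp only: nonzero_eq_divide_eq[OF u_nonzero] mult_ac)
  also have "u * z * (1 + u ^ 2) = - 1 \<longleftrightarrow> z = - 1 / (u * (1 + u ^ 2))"
    by (simp only: nonzero_eq_divide_eq[OF no_zero_divisors[OF u_nonzero u]]) (simp only: mult_ac)
  also have "v * y = - 1 \<longleftrightarrow> y = - 1 / v"
    by (simp only: nonzero_eq_divide_eq[OF v_nonzero] mult_ac)
  also have "(1 + u ^ 2) * v * y = v ^ 2 - 1 \<longleftrightarrow> y = (- 1 + v ^ 2) / ((1 + u ^ 2) * v)"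
    by (simp only: nonzero_eq_divide_eq[OF no_zero_divisors[OF u v_nonzero]] uminus_add_conv_diff)
      (simp only: mult_ac)
  finally show ?thesis by blast
qed

end

section \<open>The union of the Hecke algebras over the rational functions\<close>

lemma poly_mapping_sum_single: "(\<Sum>w\<in>Poly_Mapping.keys p. Poly_Mapping.single w (Poly_Mapping.lookup p w)) = p"
  by (rule poly_mapping_eqI) (simp add: lookup_sum lookup_single when_def in_keys_iff)

lemma scal_central: "p * scal c = scal c * p"
proof -
  have "(\<Sum>w\<in>Poly_Mapping.keys p. Poly_Mapping.single w (Poly_Mapping.lookup p w)) * scal c
      = scal c * (\<Sum>w\<in>Poly_Mapping.keys p. Poly_Mapping.single w (Poly_Mapping.lookup p w))"
    by (simp add: sum_distrib_left sum_distrib_right scal_def mult_single mult.commute)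
  then show ?thesis by (simp add: poly_mapping_sum_single)
qed

lemma scal_add: "scal (c + d) = scal c + scal d"
  by (simp add: scal_def single_add)

lemma scal_mult: "scal (c * d) = scal c * scal d"
  by (simp add: scal_def mult_single)

lemma scal_one: "scal 1 = 1"
  by (simp add: scal_def)

lemma hecke_carrier_mono: "m \<le> n \<Longrightarrow> p \<in> carrier (hecke_free m) \<Longrightarrow> p \<in> carrier (hecke_free n)"
  by (force simp: free_algebra_def hecke_gens_def)

lemma hecke_ideal_carrier: "p \<in> hecke_ideal n \<Longrightarrow> p \<in> carrier (hecke_free n)"
  using ideal.Icarr[OF ideal_hecke_ideal] .

lemma hecke_ideal_zero: "0 \<in> hecke_ideal n"
  using additive_subgroup.zero_closed[OF ideal.axioms(1)[OF ideal_hecke_ideal[of n]]]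
  by (simp add: free_algebra_simps)

text \<open>Membership means that the class is zero, and \<open>hecke_incl_class\<close> carries the
  zero class to the zero class.\<close>

lemma hecke_ideal_mono:
  assumes "m \<le> n"
  shows "p \<in> hecke_ideal m \<Longrightarrow> p \<in> hecke_ideal n"
  using assms
proof (induction n rule: dec_induct)
  case (step n)
  then have p: "p \<in> hecke_ideal n" by simp
  note car = hecke_ideal_carrier[OF p]
  have "hecke_class n p = hecke_class n 0"
    using p car by (simp add: hecke_class_eq_iff free_algebra_zero)
  then have "hecke_class (n + 1) p = hecke_class (n + 1) 0"
    using hecke_incl_class car free_algebra_zero by metis
  then show ?case
    using hecke_carrier_mono[OF _ car, of "n + 1"] by (simp add: hecke_class_eq_iff free_algebra_zero)
qed

lemma hecke_ideal_add: "p \<in> hecke_ideal n \<Longrightarrow> p' \<in> hecke_ideal n \<Longrightarrow> p + p' \<in> hecke_ideal n"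
  using additive_subgroup.a_closed[OF ideal.axioms(1)[OF ideal_hecke_ideal[of n]]]
  by (simp add: free_algebra_simps)

lemma hecke_ideal_mult:
  assumes "p \<in> hecke_ideal n" "x \<in> carrier (hecke_free n)"
  shows "x * p \<in> hecke_ideal n" "p * x \<in> hecke_ideal n"
  using ideal.I_l_closed[OF ideal_hecke_ideal assms] ideal.I_r_closed[OF ideal_hecke_ideal assms]
  by (simp_all add: free_algebra_simps)

lemma hecke_ideal_uminus: "p \<in> hecke_ideal n \<Longrightarrow> - p \<in> hecke_ideal n"
  using hecke_ideal_mult(1)[of p n "- 1"] by (simp add: free_algebra_one free_algebra_uminus)

text \<open>The generator \<open>GenG 0\<close> lies in no \<open>hecke_free n\<close>, so the relation is only partial.\<close>

definition hecke_rel :: "free_elt \<Rightarrow> free_elt \<Rightarrow> bool" where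
  "hecke_rel p p' \<longleftrightarrow> (\<exists>n. p \<in> carrier (hecke_free n) \<and> p' \<in> carrier (hecke_free n) \<and> p - p' \<in> hecke_ideal n)"

lemma hecke_relI:
  "p \<in> carrier (hecke_free n) \<Longrightarrow> p' \<in> carrier (hecke_free n) \<Longrightarrow> p - p' \<in> hecke_ideal n \<Longrightarrow> hecke_rel p p'"
  by (auto simp: hecke_rel_def)

lemma hecke_rel_refl: "p \<in> carrier (hecke_free n) \<Longrightarrow> hecke_rel p p"
  by (rule hecke_relI) (simp_all add: hecke_ideal_zero)

lemma hecke_rel_common:
  assumes "hecke_rel p p'" "hecke_rel r r'"
  obtains n where "p \<in> carrier (hecke_free n)" "p' \<in> carrier (hecke_free n)" "p - p' \<in> hecke_ideal n"
    "r \<in> carrier (hecke_free n)" "r' \<in> carrier (hecke_free n)" "r - r' \<in> hecke_ideal n"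
proof -
  obtain m k where m: "p \<in> carrier (hecke_free m)" "p' \<in> carrier (hecke_free m)" "p - p' \<in> hecke_ideal m"
    and k: "r \<in> carrier (hecke_free k)" "r' \<in> carrier (hecke_free k)" "r - r' \<in> hecke_ideal k"
    using assms by (auto simp: hecke_rel_def)
  show thesis
  proof (rule that[of "max m k"])
    show "p \<in> carrier (hecke_free (max m k))" "p' \<in> carrier (hecke_free (max m k))"
      "r \<in> carrier (hecke_free (max m k))" "r' \<in> carrier (hecke_free (max m k))"
      using m k hecke_carrier_mono[OF max.cobounded1] hecke_carrier_mono[OF max.cobounded2] by blast+
    show "p - p' \<in> hecke_ideal (max m k)" "r - r' \<in> hecke_ideal (max m k)"
      using m k hecke_ideal_mono[OF max.cobounded1] hecke_ideal_mono[OF max.cobounded2] by blast+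
  qed
qed

\<comment> \<open>The direct limit of the Hecke algebras: elements are identified once their classes
  agree at some level \<open>n\<close>. A type is required because the abstract locales work over
  type-class rings.\<close>
quotient_type hecke_union = free_elt / partial: hecke_rel
proof (rule part_equivpI)
  show "\<exists>p. hecke_rel p p"
    using hecke_rel_refl[OF free_algebra_zero] by blast
  show "symp hecke_rel"
  proof (rule sympI)
    fix p p' assume "hecke_rel p p'"
    then obtain n where "p \<in> carrier (hecke_free n)" "p' \<in> carrier (hecke_free n)" "p - p' \<in> hecke_ideal n"
      by (auto simp: hecke_rel_def)
    then show "hecke_rel p' p"
      using hecke_ideal_uminus[of "p - p'" n] by (auto intro: hecke_relI)
  qed
  show "transp hecke_rel"
  proof (rule transpI)
    fix p p' p'' assume "hecke_rel p p'" "hecke_rel p' p''"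
    then obtain n where "p \<in> carrier (hecke_free n)" "p - p' \<in> hecke_ideal n"
      "p'' \<in> carrier (hecke_free n)" "p' - p'' \<in> hecke_ideal n"
      by (rule hecke_rel_common)
    then show "hecke_rel p p''"
      using hecke_ideal_add[of "p - p'" n "p' - p''"] by (auto intro: hecke_relI)
  qed
qed

instantiation hecke_union :: ring
begin

lift_definition zero_hecke_union :: hecke_union is "0"
  by (rule hecke_rel_refl[OF free_algebra_zero])

lift_definition plus_hecke_union :: "hecke_union \<Rightarrow> hecke_union \<Rightarrow> hecke_union" is "(+)"
proof -
  fix p p' r r' assume "hecke_rel p p'" "hecke_rel r r'"
  then show "hecke_rel (p + r) (p' + r')"
  proof (rule hecke_rel_common)
    fix n assume n: "p \<in> carrier (hecke_free n)" "p' \<in> carrier (hecke_free n)" "p - p' \<in> hecke_ideal n"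
      "r \<in> carrier (hecke_free n)" "r' \<in> carrier (hecke_free n)" "r - r' \<in> hecke_ideal n"
    have "(p + r) - (p' + r') = (p - p') + (r - r')" by simp
    then show ?thesis
      using n hecke_ideal_add[OF n(3,6)]
      by (intro hecke_relI[of _ n]) (simp_all only: free_algebra_add)
  qed
qed

lift_definition times_hecke_union :: "hecke_union \<Rightarrow> hecke_union \<Rightarrow> hecke_union" is "(*)"
proof -
  fix p p' r r' assume "hecke_rel p p'" "hecke_rel r r'"
  then show "hecke_rel (p * r) (p' * r')"
  proof (rule hecke_rel_common)
    fix n assume n: "p \<in> carrier (hecke_free n)" "p' \<in> carrier (hecke_free n)" "p - p' \<in> hecke_ideal n"
      "r \<in> carrier (hecke_free n)" "r' \<in> carrier (hecke_free n)" "r - r' \<in> hecke_ideal n"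
    have "p * r - p' * r' = (p - p') * r + p' * (r - r')" by (simp add: algebra_simps)
    then have "p * r - p' * r' \<in> hecke_ideal n"
      using hecke_ideal_add[OF hecke_ideal_mult(2)[OF n(3,4)] hecke_ideal_mult(1)[OF n(6,2)]] by simp
    then show ?thesis
      using n by (intro hecke_relI[of _ n]) (simp_all add: free_algebra_mult)
  qed
qed

lift_definition uminus_hecke_union :: "hecke_union \<Rightarrow> hecke_union" is "uminus"
proof -
  fix p p' assume "hecke_rel p p'"
  then obtain n where n: "p \<in> carrier (hecke_free n)" "p' \<in> carrier (hecke_free n)" "p - p' \<in> hecke_ideal n"
    by (auto simp: hecke_rel_def)
  then show "hecke_rel (- p) (- p')"
    using hecke_ideal_uminus[OF n(3)]
    by (intro hecke_relI[of _ n]) (simp_all add: free_algebra_uminus)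
qed

definition minus_hecke_union :: "hecke_union \<Rightarrow> hecke_union \<Rightarrow> hecke_union" where
  "minus_hecke_union x x' = x + - x'"

text \<open>Since the relation is partial, transfer leaves reflexivity goals for compound terms;
  they hold because the parts lie in a common \<open>hecke_free n\<close>.\<close>

lemma hecke_rel_refl_add: "hecke_rel p p \<Longrightarrow> hecke_rel r r \<Longrightarrow> hecke_rel (p + r) (p + r)"
  by (erule (1) hecke_rel_common) (rule hecke_rel_refl, erule (1) free_algebra_add)

lemma hecke_rel_refl_mult: "hecke_rel p p \<Longrightarrow> hecke_rel r r \<Longrightarrow> hecke_rel (p * r) (p * r)"
  by (erule (1) hecke_rel_common) (rule hecke_rel_refl, erule (1) free_algebra_mult)

instance
proof
  fix x y w :: hecke_union
  show "x + y + w = x + (y + w)"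
    by transfer (simp add: add.assoc hecke_rel_refl_add)
  show "x + y = y + x"
    by transfer (metis add.commute hecke_rel_refl_add)
  show "0 + x = x"
    by transfer simp
  show "- x + x = 0"
    by transfer (simp add: hecke_rel_refl[OF free_algebra_zero])
  show "x - y = x + - y"
    by (simp add: minus_hecke_union_def)
  show "x * y * w = x * (y * w)"
    by transfer (simp add: mult.assoc hecke_rel_refl_mult)
  show "(x + y) * w = x * w + y * w"
    by transfer (simp add: distrib_right hecke_rel_refl_add hecke_rel_refl_mult)
  show "x * (y + w) = x * y + x * w"
    by transfer (simp add: distrib_left hecke_rel_refl_add hecke_rel_refl_mult)
qed

end

instantiation hecke_union :: monoid_mult
begin

lift_definition one_hecke_union :: hecke_union is "1"
  by (rule hecke_rel_refl[OF free_algebra_one])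

instance
proof
  fix x :: hecke_union
  show "1 * x = x" "x * 1 = x"
    by (transfer; simp)+
qed

end

section \<open>The map from the free algebra and the relations in the union\<close>

abbreviation hu :: "free_elt \<Rightarrow> hecke_union" where
  "hu \<equiv> abs_hecke_union"

text \<open>The level is raised by one to make it positive, where the axioms of a Markov trace
  apply.\<close>

lemma hu_cases: obtains p n where "1 \<le> n" "p \<in> carrier (hecke_free n)" "x = hu p"
proof -
  obtain n where n: "rep_hecke_union x \<in> carrier (hecke_free n)"
    using Quotient_rep_reflp[OF Quotient_hecke_union, of x] by (auto simp: hecke_rel_def)
  show thesis
  proof (rule that)
    show "rep_hecke_union x \<in> carrier (hecke_free (Suc n))"
      by (rule hecke_carrier_mono[OF _ n]) simp
  qed (simp_all add: Quotient_abs_rep[OF Quotient_hecke_union])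
qed

lemma hu_add:
  "p \<in> carrier (hecke_free n) \<Longrightarrow> p' \<in> carrier (hecke_free n) \<Longrightarrow> hu (p + p') = hu p + hu p'"
  by (simp add: plus_hecke_union.abs_eq hecke_rel_refl)

lemma hu_mult:
  "p \<in> carrier (hecke_free n) \<Longrightarrow> p' \<in> carrier (hecke_free n) \<Longrightarrow> hu (p * p') = hu p * hu p'"
  by (simp add: times_hecke_union.abs_eq hecke_rel_refl)

lemma hu_uminus: "p \<in> carrier (hecke_free n) \<Longrightarrow> hu (- p) = - hu p"
  by (simp add: uminus_hecke_union.abs_eq hecke_rel_refl)

lemma hu_diff:
  "p \<in> carrier (hecke_free n) \<Longrightarrow> p' \<in> carrier (hecke_free n) \<Longrightarrow> hu (p - p') = hu p - hu p'"
  using hu_add[of p n "- p'"] by (simp add: free_algebra_uminus hu_uminus)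

lemma hu_one: "hu 1 = 1"
  by (simp add: one_hecke_union.abs_eq)

lemma hu_eq_iff:
  assumes "p \<in> carrier (hecke_free n)" "p' \<in> carrier (hecke_free n)"
  shows "hu p = hu p' \<longleftrightarrow> hecke_rel p p'"
  using Quotient_rel[OF Quotient_hecke_union, of p p'] assms by (auto intro: hecke_rel_refl)

lemma hu_relation: "p - p' \<in> hecke_relations n \<Longrightarrow> p \<in> carrier (hecke_free n) \<Longrightarrow>
    p' \<in> carrier (hecke_free n) \<Longrightarrow> hu p = hu p'"
  using subsetD[OF ring.genideal_self[OF ring_free_algebra hecke_relations_subset], of "p - p'" n]
  by (simp add: hu_eq_iff hecke_ideal_def[symmetric] hecke_relI)

lemma hecke_free_gens:
  "B1 \<in> carrier (hecke_free n)" "1 \<le> i \<Longrightarrow> i < n \<Longrightarrow> G i \<in> carrier (hecke_free n)"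
  by (auto intro!: free_algebra_gen simp: hecke_gens_def)

lemmas hecke_free_closed = free_algebra_closed(1-6) free_algebra_minus free_algebra_power hecke_free_gens

lemmas hu_hom = hu_add hu_mult hu_diff

lemma hecke_relationsI:
  "i \<in> {1..<n} \<Longrightarrow> j \<in> {1..<n} \<Longrightarrow> \<bar>int i - int j\<bar> > 1 \<Longrightarrow> G i * G j - G j * G i \<in> hecke_relations n"
  "i \<in> {1..<n} \<Longrightarrow> i + 1 \<in> {1..<n} \<Longrightarrow>
    G i * G (i + 1) * G i - G (i + 1) * G i * G (i + 1) \<in> hecke_relations n"
  "i \<in> {1..<n} \<Longrightarrow> i > 1 \<Longrightarrow> B1 * G i - G i * B1 \<in> hecke_relations n"
  "i \<in> {1..<n} \<Longrightarrow> i = 1 \<Longrightarrow> B1 * G i * B1 * G i - G i * B1 * G i * B1 \<in> hecke_relations n"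
  "i \<in> {1..<n} \<Longrightarrow> G i ^ 2 - (1 + scal (ind_u - inverse ind_u) * G i) \<in> hecke_relations n"
  "B1 ^ 2 - (1 + scal (ind_v - inverse ind_v) * B1) \<in> hecke_relations n"
  unfolding hecke_relations_def by blast+

interpretation HU: hecke_type_B ind_u ind_v "\<lambda>c. hu (scal c)" "hu B1" "\<lambda>i. hu (G i)"
proof
  fix c d x and i j :: nat
  show "hu (scal (c + d)) = hu (scal c) + hu (scal d)"
    by (simp add: scal_add hu_add free_algebra_scal)
  show "hu (scal (c * d)) = hu (scal c) * hu (scal d)"
    by (simp add: scal_mult hu_mult free_algebra_scal)
  show "hu (scal 1) = 1"
    by (simp add: scal_one hu_one)
  show "x * hu (scal c) = hu (scal c) * x"
  proof (cases x rule: hu_cases)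
    case (1 p n)
    then show ?thesis
      using hu_mult[of p n "scal c"] hu_mult[of "scal c" n p] by (simp add: free_algebra_scal scal_central)
  qed
  show "ind_u \<noteq> 0" "ind_v \<noteq> 0"
    by (simp_all add: ind_u_def ind_v_def Zero_fract_def eq_fract)
  show "hu (G i) * hu (G j) = hu (G j) * hu (G i)" if "1 \<le> i" "i + 1 < j"
  proof -
    have "hu (G i * G j) = hu (G j * G i)"
    proof (rule hu_relation[where n = "j + 1"])
      show "G i * G j - G j * G i \<in> hecke_relations (j + 1)"
        using that by (intro hecke_relationsI) auto
    qed (use that in \<open>simp_all add: hecke_free_closed\<close>)
    then show ?thesis using that by (simp add: hu_mult[where n = "j + 1"] hecke_free_closed)
  qed
  show "hu (G i) * hu (G (Suc i)) * hu (G i) = hu (G (Suc i)) * hu (G i) * hu (G (Suc i))" if "1 \<le> i"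
  proof -
    have "hu (G i * G (i + 1) * G i) = hu (G (i + 1) * G i * G (i + 1))"
    proof (rule hu_relation[where n = "i + 2"])
      show "G i * G (i + 1) * G i - G (i + 1) * G i * G (i + 1) \<in> hecke_relations (i + 2)"
        using that by (intro hecke_relationsI) auto
    qed (use that in \<open>simp_all add: hecke_free_closed\<close>)
    then show ?thesis using that by (simp add: hu_mult[where n = "i + 2"] hecke_free_closed)
  qed
  show "hu B1 * hu (G i) = hu (G i) * hu B1" if "1 < i"
  proof -
    have "hu (B1 * G i) = hu (G i * B1)"
    proof (rule hu_relation[where n = "i + 1"])
      show "B1 * G i - G i * B1 \<in> hecke_relations (i + 1)"
        using that by (intro hecke_relationsI) auto
    qed (use that in \<open>simp_all add: hecke_free_closed\<close>)
    then show ?thesis using that by (simp add: hu_mult[where n = "i + 1"] hecke_free_closed)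
  qed
  show "hu B1 * hu (G 1) * hu B1 * hu (G 1) = hu (G 1) * hu B1 * hu (G 1) * hu B1"
  proof -
    have "hu (B1 * G 1 * B1 * G 1) = hu (G 1 * B1 * G 1 * B1)"
    proof (rule hu_relation[where n = 2])
      show "B1 * G 1 * B1 * G 1 - G 1 * B1 * G 1 * B1 \<in> hecke_relations 2"
        by (intro hecke_relationsI) auto
    qed (simp_all add: hecke_free_closed)
    then show ?thesis by (simp add: hu_mult[where n = 2] hecke_free_closed)
  qed
  show "hu (G i) * hu (G i) = 1 + hu (scal (ind_u - inverse ind_u)) * hu (G i)" if "1 \<le> i"
  proof -
    have "hu (G i ^ 2) = hu (1 + scal (ind_u - inverse ind_u) * G i)"
    proof (rule hu_relation[where n = "i + 1"])
      show "G i ^ 2 - (1 + scal (ind_u - inverse ind_u) * G i) \<in> hecke_relations (i + 1)"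
        using that by (intro hecke_relationsI) auto
    qed (use that in \<open>simp_all add: hecke_free_closed\<close>)
    then show ?thesis
      using that by (simp add: power2_eq_square hu_hom[where n = "i + 1"] hu_one hecke_free_closed)
  qed
  show "hu B1 * hu B1 = 1 + hu (scal (ind_v - inverse ind_v)) * hu B1"
  proof -
    have "hu (B1 ^ 2) = hu (1 + scal (ind_v - inverse ind_v) * B1)"
    proof (rule hu_relation[where n = 1])
      show "B1 ^ 2 - (1 + scal (ind_v - inverse ind_v) * B1) \<in> hecke_relations 1"
        by (rule hecke_relationsI)
    qed (simp_all add: hecke_free_closed)
    then show ?thesis
      by (simp add: power2_eq_square hu_hom[where n = 1] hu_one hecke_free_closed)
  qed
qed

section \<open>Identification of \<open>H n\<close> and of the distinguished elements\<close>

lemma hu_H: "p \<in> carrier (hecke_free n) \<Longrightarrow> hu p \<in> HU.H n"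
proof -
  have word: "hu (Poly_Mapping.single (Word xs) c) \<in> HU.H n \<and>
      Poly_Mapping.single (Word xs) c \<in> carrier (hecke_free n)" if "set xs \<subseteq> hecke_gens n" for xs c
    using that
  \<comment> \<open>Letters are split off at the end, matching the rules of
    \<open>H\<close>.\<close>
  proof (induction xs rule: rev_induct)
    case Nil
    have "(Poly_Mapping.single (Word []) c :: free_elt) = scal c"
      by (simp add: scal_def zero_free_word_def)
    then show ?case using HU.H_scalar[of c n] by (simp add: free_algebra_scal)
  next
    case (snoc x xs)
    let ?p = "Poly_Mapping.single (Word xs) c"
    have x: "x \<in> hecke_gens n" and IH: "hu ?p \<in> HU.H n" "?p \<in> carrier (hecke_free n)"
      using snoc by auto
    have eq: "Poly_Mapping.single (Word (xs @ [x])) c = ?p * free_gen x"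
      by (simp add: free_gen_def mult_single plus_free_word_def)
    have gen: "free_gen x \<in> carrier (hecke_free n)" using x by (rule free_algebra_gen)
    have "hu ?p * hu (free_gen x) \<in> HU.H n"
      using x IH by (auto simp: hecke_gens_def intro: HU.H_mult_b HU.H_mult_g)
    then show ?case
      using IH gen hu_mult[OF IH(2) gen] by (simp add: eq free_algebra_mult)
  qed
  assume p: "p \<in> carrier (hecke_free n)"
  have "hu (\<Sum>w\<in>A. Poly_Mapping.single w (Poly_Mapping.lookup p w)) \<in> HU.H n \<and>
      (\<Sum>w\<in>A. Poly_Mapping.single w (Poly_Mapping.lookup p w)) \<in> carrier (hecke_free n)"
    if "finite A" "A \<subseteq> Poly_Mapping.keys p" for A
    using that
  proof (induction A rule: finite_induct)
    case empty
    have "hu 0 = 0" by (simp add: zero_hecke_union.abs_eq)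
    then show ?case using HU.H_scalar[of 0 n] by (simp add: HU.s_zero free_algebra_zero)
  next
    case (insert w A)
    then have "set (letters w) \<subseteq> hecke_gens n"
      using p by (auto simp: free_algebra_def)
    then show ?case
      using insert word[of "letters w"] by (auto simp: hu_add[of _ n] free_algebra_add HU.H_add)
  qed
  from this[of "Poly_Mapping.keys p"] show "hu p \<in> HU.H n"
    by (simp add: poly_mapping_sum_single)
qed

lemma H_hu: "x \<in> HU.H n \<Longrightarrow> \<exists>p \<in> carrier (hecke_free n). x = hu p"
proof (induction rule: HU.H.induct)
  case (H_scalar c)
  show ?case using free_algebra_scal by blast
next
  case (H_add x w)
  then show ?case by (metis free_algebra_add hu_add)
next
  case (H_mult_b x)
  then show ?case by (metis free_algebra_mult hu_mult hecke_free_gens(1))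
next
  case (H_mult_g x i)
  then show ?case by (metis free_algebra_mult hu_mult hecke_free_gens(2))
qed

lemma H_eq_image: "HU.H n = hu ` carrier (hecke_free n)"
  using H_hu hu_H by blast

lemma hu_gBe: "HU.gBe = hu gB"
  by (simp add: HU.gBe_def gB_def hu_hom[where n = 2] hu_one hecke_free_closed)

lemma hu_g12e: "HU.g12e = hu g12"
  by (simp add: HU.g12e_def g12_def hu_hom[where n = 3] hu_one hecke_free_closed)

text \<open>A representative of \<open>b_(k+1)\<close> in the free algebra: the quadratic relation
  supplies \<open>g_i - (u - 1/u)\<close> for the inverse of \<open>g_i\<close>.\<close>

primrec free_b :: "nat \<Rightarrow> free_elt" where
  "free_b 0 = B1"
| "free_b (Suc k) = G (Suc k) * free_b k * (G (Suc k) - scal (ind_u - inverse ind_u))"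

lemma free_b_closed: "k < n \<Longrightarrow> free_b k \<in> carrier (hecke_free n)"
  by (induction k) (simp_all add: hecke_free_closed)

lemma hu_b_conj: "HU.b_conj k = hu (free_b k)"
proof (induction k)
  case (Suc k)
  then show ?case
    by (simp add: HU.g_inv_def hu_hom[where n = "Suc (Suc k)"] hecke_free_closed free_b_closed)
qed simp

lemma hecke_class_mult:
  "p \<in> carrier (hecke_free n) \<Longrightarrow> p' \<in> carrier (hecke_free n) \<Longrightarrow>
    hecke_class n p \<otimes>\<^bsub>hecke n\<^esub> hecke_class n p' = hecke_class n (p * p')"
  using ring_hom_mult[OF hecke_class_hom] by (simp add: free_algebra_simps)

lemma hecke_class_add:
  "p \<in> carrier (hecke_free n) \<Longrightarrow> p' \<in> carrier (hecke_free n) \<Longrightarrow>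
    hecke_class n p \<oplus>\<^bsub>hecke n\<^esub> hecke_class n p' = hecke_class n (p + p')"
  using ring_hom_add[OF hecke_class_hom] by (simp add: free_algebra_simps)

lemma hecke_class_one: "hecke_class n 1 = \<one>\<^bsub>hecke n\<^esub>"
  using ring_hom_one[OF hecke_class_hom, of n] by (simp add: free_algebra_simps)

lemma hecke_class_closed: "p \<in> carrier (hecke_free n) \<Longrightarrow> hecke_class n p \<in> carrier (hecke n)"
  by (simp add: carrier_hecke)

lemma hecke_b_class: "k < n \<Longrightarrow> hecke_b n (Suc k) = hecke_class n (free_b k)"
proof (induction k)
  case (Suc k)
  have "hecke_b n (Suc (Suc k)) = hecke_class n (G (Suc k)) \<otimes>\<^bsub>hecke n\<^esub> hecke_b n (Suc k)
      \<otimes>\<^bsub>hecke n\<^esub> inv\<^bsub>hecke n\<^esub> (hecke_class n (G (Suc k)))"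
    by (simp add: hecke_b_def)
  also have "\<dots> = hecke_class n (free_b (Suc k))"
    using Suc by (simp add: hecke_g_inverse hecke_class_mult hecke_free_closed free_b_closed)
  finally show ?case .
qed (simp add: hecke_b_def)

section \<open>The trace on the union\<close>

definition union_trace :: "(nat \<Rightarrow> free_elt set \<Rightarrow> ratfun) \<Rightarrow> hecke_union \<Rightarrow> ratfun" where
  "union_trace \<tau> x = (THE c. \<exists>n p. 1 \<le> n \<and> p \<in> carrier (hecke_free n) \<and> x = hu p \<and> c = \<tau> n (hecke_class n p))"

context
  fixes z y \<tau> assumes markov: "markov_trace z y \<tau>"
begin

lemma markov_mono:
  assumes "m \<le> n" "1 \<le> m" "p \<in> carrier (hecke_free m)"
  shows "\<tau> n (hecke_class n p) = \<tau> m (hecke_class m p)"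
  using assms(1)
proof (induction n rule: dec_induct)
  case (step n)
  have p: "p \<in> carrier (hecke_free n)" using step assms by (simp add: hecke_carrier_mono)
  have "\<tau> (n + 1) (hecke_incl n (hecke_class n p)) = \<tau> n (hecke_class n p)"
    using markov step assms p by (simp add: markov_trace_def hecke_class_closed)
  then show ?case using step p by (simp add: hecke_incl_class)
qed simp

lemma union_trace_eq:
  assumes "1 \<le> n" "p \<in> carrier (hecke_free n)"
  shows "union_trace \<tau> (hu p) = \<tau> n (hecke_class n p)"
  unfolding union_trace_def
proof (rule the_equality)
  fix c assume "\<exists>m p'. 1 \<le> m \<and> p' \<in> carrier (hecke_free m) \<and> hu p = hu p' \<and> c = \<tau> m (hecke_class m p')"
  then obtain m p' where m: "1 \<le> m" "p' \<in> carrier (hecke_free m)" "hu p = hu p'"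
    "c = \<tau> m (hecke_class m p')" by blast
  define N where "N = max m n"
  have car: "p \<in> carrier (hecke_free N)" "p' \<in> carrier (hecke_free N)"
    unfolding N_def
    using hecke_carrier_mono[OF max.cobounded2 assms(2)] hecke_carrier_mono[OF max.cobounded1 m(2)] by blast+
  then obtain k where k: "p - p' \<in> hecke_ideal k"
    using m(3) by (auto simp: hu_eq_iff hecke_rel_def)
  \<comment> \<open>At level \<open>M\<close> both representatives are present and the ideal
    contains their difference, so their classes coincide; \<open>markov_mono\<close> compares this
    level with the two given ones.\<close>
  define M where "M = max N k"
  have "hecke_class M p = hecke_class M p'"
    using hecke_ideal_mono[OF _ k, of M] car hecke_carrier_mono[of N M]
    by (simp add: M_def hecke_class_eq_iff)
  moreover have "n \<le> M" "m \<le> M" by (simp_all add: M_def N_def)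
  ultimately show "c = \<tau> n (hecke_class n p)"
    using markov_mono[of n M p] markov_mono[of m M p'] m assms by simp
qed (use assms in blast)

lemma markov_union: "markov_type_B ind_u ind_v (\<lambda>c. hu (scal c)) (hu B1) (\<lambda>i. hu (G i)) z y (union_trace \<tau>)"
proof
  fix x w :: hecke_union and c :: ratfun
  obtain p m where p: "1 \<le> m" "p \<in> carrier (hecke_free m)" "x = hu p" by (rule hu_cases)
  obtain p' m' where p': "1 \<le> m'" "p' \<in> carrier (hecke_free m')" "w = hu p'" by (rule hu_cases)
  define n where "n = max m m'"
  have n: "1 \<le> n" and car: "p \<in> carrier (hecke_free n)" "p' \<in> carrier (hecke_free n)"
    unfolding n_def using p(1) hecke_carrier_mono[OF max.cobounded1 p(2)]
      hecke_carrier_mono[OF max.cobounded2 p'(2)] by (simp_all add: le_max_iff_disj)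
  have lin: "hecke_linear n (\<tau> n)" using markov n by (simp add: markov_trace_def)
  show "union_trace \<tau> (x + w) = union_trace \<tau> x + union_trace \<tau> w"
    using n car lin p(3) p'(3)
    by (simp add: hu_add[symmetric, of _ n] union_trace_eq free_algebra_add hecke_class_add[symmetric]
      hecke_linear_def hecke_class_closed)
  have "hecke_scale n c (hecke_class n p) = hecke_class n (scal c * p)"
    using car by (simp add: hecke_scale_def hecke_class_mult free_algebra_scal)
  then show "union_trace \<tau> (hu (scal c) * x) = c * union_trace \<tau> x"
    using n car lin p(3)
    by (simp add: hu_mult[symmetric, of _ n] union_trace_eq free_algebra_closed)
      (metis hecke_linear_def hecke_class_closed)
  show "union_trace \<tau> 1 = 1"
    using union_trace_eq[of 1 1] markov
    by (simp add: hu_one free_algebra_one hecke_class_one markov_trace_def)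
  have "\<tau> n (hecke_class n p \<otimes>\<^bsub>hecke n\<^esub> hecke_class n p') = \<tau> n (hecke_class n p' \<otimes>\<^bsub>hecke n\<^esub> hecke_class n p)"
    using markov n car by (simp add: markov_trace_def hecke_class_closed)
  then show "union_trace \<tau> (x * w) = union_trace \<tau> (w * x)"
    using n car p(3) p'(3)
    by (simp add: hu_mult[symmetric, of _ n] union_trace_eq free_algebra_mult hecke_class_mult)
next
  fix n :: nat and x assume n: "1 \<le> n" and x: "x \<in> HU.H n"
  then obtain p where p: "p \<in> carrier (hecke_free n)" "x = hu p" using H_hu by blast
  have car: "p \<in> carrier (hecke_free (n + 1))" using hecke_carrier_mono[OF _ p(1)] by simp
  have G: "G n \<in> carrier (hecke_free (n + 1))" using n by (simp add: hecke_free_closed)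
  have b: "free_b n \<in> carrier (hecke_free (n + 1))" by (simp add: free_b_closed)
  have "\<tau> (n + 1) (hecke_incl n (hecke_class n p) \<otimes>\<^bsub>hecke (n + 1)\<^esub> hecke_class (n + 1) (G n))
      = z * \<tau> n (hecke_class n p)"
    using markov n p by (simp add: markov_trace_def hecke_class_closed)
  then show "union_trace \<tau> (x * hu (G n)) = z * union_trace \<tau> x"
    using p n car G union_trace_eq[of "n + 1" "p * G n"] union_trace_eq[of n p]
    by (simp add: hu_mult[of _ "Suc n"] hecke_incl_class hecke_class_mult free_algebra_mult)
  have "\<tau> (n + 1) (hecke_incl n (hecke_class n p) \<otimes>\<^bsub>hecke (n + 1)\<^esub> hecke_b (n + 1) (n + 1))
      = y * \<tau> n (hecke_class n p)"
    using markov n p by (simp add: markov_trace_def hecke_class_closed)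
  then show "union_trace \<tau> (x * HU.b_conj n) = y * union_trace \<tau> x"
    using p n car b union_trace_eq[of "n + 1" "p * free_b n"] union_trace_eq[of n p]
    by (simp add: hu_b_conj hu_mult[of _ "Suc n"] hecke_incl_class hecke_class_mult free_algebra_mult hecke_b_class)
qed

text \<open>The radical \<open>K\<close> of the form \<open>(c, a) -> tau (c * a)\<close> is a
  two-sided ideal on which the trace vanishes. Hence the trace vanishes on the generated ideal as
  soon as both generators lie in \<open>K\<close>.\<close>

lemma passes_iff:
  assumes n: "3 \<le> n"
  shows "passes_to_TLB n (\<tau> n) \<longleftrightarrow> (\<forall>x \<in> HU.H n. union_trace \<tau> (x * HU.gBe) = 0 \<and> union_trace \<tau> (x * HU.g12e) = 0)"
    (is "_ \<longleftrightarrow> ?van")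
proof -
  interpret R: ring "hecke n" by (rule ring_hecke)
  interpret I: ideal "TLB_ideal n" "hecke n" by (rule ideal_TLB_ideal[OF n])
  have gens: "gB \<in> carrier (hecke_free n)" "g12 \<in> carrier (hecke_free n)"
    using n unfolding gB_def g12_def by (simp_all add: hecke_free_closed)
  have tr: "union_trace \<tau> (hu p * hu f) = \<tau> n (hecke_class n p \<otimes>\<^bsub>hecke n\<^esub> hecke_class n f)"
    if "p \<in> carrier (hecke_free n)" "f \<in> carrier (hecke_free n)" for p f
    using n that by (simp add: hu_mult[symmetric, of _ n] union_trace_eq hecke_class_mult free_algebra_mult)
  have van: "?van \<longleftrightarrow> (\<forall>a \<in> carrier (hecke n). \<tau> n (a \<otimes>\<^bsub>hecke n\<^esub> hecke_class n gB) = 0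
      \<and> \<tau> n (a \<otimes>\<^bsub>hecke n\<^esub> hecke_class n g12) = 0)"
    (is "_ \<longleftrightarrow> ?van'")
    unfolding hu_gBe hu_g12e carrier_hecke H_eq_image using tr gens by simp
  have self: "{hecke_class n gB, hecke_class n g12} \<subseteq> TLB_ideal n"
    unfolding TLB_ideal_def by (rule R.genideal_self) (simp add: TLB_ideal_generators[OF n])
  have lin: "hecke_linear n (\<tau> n)" using markov n by (simp add: markov_trace_def)
  then have add: "\<tau> n (a \<oplus>\<^bsub>hecke n\<^esub> a') = \<tau> n a + \<tau> n a'"
    if "a \<in> carrier (hecke n)" "a' \<in> carrier (hecke n)" for a a'
    using that by (simp add: hecke_linear_def)
  have comm: "\<tau> n (a \<otimes>\<^bsub>hecke n\<^esub> a') = \<tau> n (a' \<otimes>\<^bsub>hecke n\<^esub> a)"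
    if "a \<in> carrier (hecke n)" "a' \<in> carrier (hecke n)" for a a'
    using markov n that by (simp add: markov_trace_def)
  have zero: "\<tau> n \<zero>\<^bsub>hecke n\<^esub> = 0"
    using add[of "\<zero>\<^bsub>hecke n\<^esub>" "\<zero>\<^bsub>hecke n\<^esub>"]
    by (metis R.r_zero R.zero_closed add_cancel_right_right)
  have "passes_to_TLB n (\<tau> n) \<longleftrightarrow> ?van'"
  proof
    assume "passes_to_TLB n (\<tau> n)"
    then show ?van'
      using self I.I_l_closed by (auto simp: passes_to_TLB_def)
  next
    assume van': ?van'
    define K where "K = {a \<in> carrier (hecke n). \<forall>c \<in> carrier (hecke n). \<tau> n (c \<otimes>\<^bsub>hecke n\<^esub> a) = 0}"
    have "ideal K (hecke n)"
    proof (rule idealI[OF ring_hecke])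
      show "subgroup K (add_monoid (hecke n))"
      proof (rule R.add.subgroupI)
        show "K \<noteq> {}" using zero by (auto simp: K_def)
        fix a a' assume a: "a \<in> K" "a' \<in> K"
        then show "a \<oplus>\<^bsub>hecke n\<^esub> a' \<in> K"
          by (auto simp: K_def R.r_distr add)
        have "\<tau> n (c \<otimes>\<^bsub>hecke n\<^esub> (\<ominus>\<^bsub>hecke n\<^esub> a)) = 0" if c: "c \<in> carrier (hecke n)" for c
        proof -
          have "\<tau> n (c \<otimes>\<^bsub>hecke n\<^esub> (\<ominus>\<^bsub>hecke n\<^esub> a)) = \<tau> n ((\<ominus>\<^bsub>hecke n\<^esub> c) \<otimes>\<^bsub>hecke n\<^esub> a)"
            using a c by (simp add: K_def R.l_minus R.r_minus)
          then show ?thesis using a c by (simp add: K_def)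
        qed
        then show "\<ominus>\<^bsub>hecke n\<^esub> a \<in> K" using a by (simp add: K_def)
      qed (auto simp: K_def)
      fix a c assume a: "a \<in> K" and c: "c \<in> carrier (hecke n)"
      show "c \<otimes>\<^bsub>hecke n\<^esub> a \<in> K"
        using a c by (auto simp: K_def R.m_assoc[symmetric])
      have "\<tau> n (d \<otimes>\<^bsub>hecke n\<^esub> (a \<otimes>\<^bsub>hecke n\<^esub> c)) = 0" if d: "d \<in> carrier (hecke n)" for d
      proof -
        \<comment> \<open>Cyclicity moves the right factor \<open>c\<close> to the front, which
          makes the radical closed under right multiplication.\<close>
        have "\<tau> n (d \<otimes>\<^bsub>hecke n\<^esub> (a \<otimes>\<^bsub>hecke n\<^esub> c)) = \<tau> n (c \<otimes>\<^bsub>hecke n\<^esub> (d \<otimes>\<^bsub>hecke n\<^esub> a))"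
          using a c d comm[of "d \<otimes>\<^bsub>hecke n\<^esub> a" c] by (simp add: K_def R.m_assoc)
        then show ?thesis using a c d by (simp add: K_def R.m_assoc[symmetric])
      qed
      then show "a \<otimes>\<^bsub>hecke n\<^esub> c \<in> K" using a c by (simp add: K_def)
    qed
    moreover have "{hecke_class n gB, hecke_class n g12} \<subseteq> K"
      using van' TLB_ideal_generators[OF n] by (auto simp: K_def)
    ultimately have "TLB_ideal n \<subseteq> K"
      unfolding TLB_ideal_def by (rule R.genideal_minimal)
    moreover have "\<tau> n a = 0" if a: "a \<in> K" for a
    proof -
      have "\<tau> n (\<one>\<^bsub>hecke n\<^esub> \<otimes>\<^bsub>hecke n\<^esub> a) = 0"
        using a R.one_closed unfolding K_def by blast
      then show ?thesis using a by (simp add: K_def)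
    qed
    ultimately show "passes_to_TLB n (\<tau> n)"
      by (auto simp: passes_to_TLB_def)
  qed
  with van show ?thesis by simp
qed

end

lemma one_plus_ind_u_square: "1 + ind_u ^ 2 \<noteq> 0"
  by (simp add: ind_u_def power2_eq_square One_fract_def Zero_fract_def eq_fract one_pCons)

theorem theorem4:
  fixes n :: nat and z y :: ratfun and \<tau> :: "nat \<Rightarrow> free_elt set \<Rightarrow> ratfun"
  assumes "n \<ge> 3"
    and "markov_trace z y \<tau>"
  shows "passes_to_TLB n (\<tau> n) \<longleftrightarrow>
      (z = - 1 / ind_u \<and> y = - 1 / ind_v) \<or>
      (z = - 1 / ind_u \<and> y = ind_v) \<or>
      (z = - 1 / (ind_u * (1 + ind_u ^ 2)) \<and> y = - 1 / ind_v) \<or>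
      (z = - 1 / (ind_u * (1 + ind_u ^ 2)) \<and> y = (- 1 + ind_v ^ 2) / ((1 + ind_u ^ 2) * ind_v))"
  using passes_iff[OF assms(2,1)] markov_type_B.vanishing_iff[OF markov_union[OF assms(2)] assms(1) one_plus_ind_u_square]
  by simp

end
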